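(* Fix $0<\delta<1$. Suppose $m\ge\delta n$, $n\ge\delta m$, and $\delta\tau\le\zeta_{jk}\le\tau$ for all $j,k$ and some $\tau$ with $\delta\le\tau\le(m+n)^{1/\delta}$. Let $$\mathcal U=\left\{(s,t)\in\Pi_0:\ |s_j|,|t_k|\le\frac{\ln(m+n)}{\tau\sqrt{m+n}}\ \text{for all } j,k\right\}.$$ Then for any $\kappa>0$ there is $\gamma(\delta,\kappa)>0$ such that if $m+n>\gamma(\delta,\kappa)$ then $$\int_{\Pi_0\setminus\mathcal U}|F(s,t)|\,ds\,dt\le(m+n)^{-\kappa}\int_{\Pi_0}|F(s,t)|\,ds\,dt.$$
   Context: $R=(r_1,\dots,r_m)$, $C=(c_1,\dots,c_n)$ are positive integer margins with equal sums, and $Z=(\zeta_{jk})$ is their typical matrix: the unique maximizer of $g(X)=\sum_{j,k}((x_{jk}+1)\ln(x_{jk}+1)-x_{jk}\ln x_{jk})$ over real non-negative $m\times n$ matrices with row sums $R$, column sums $C$ (entries positive). $F(s,t)=\exp\{-i\sum_jr_js_j-i\sum_kc_kt_k\}\prod_{j,k}(1+\zeta_{jk}-\zeta_{jk}e^{i(s_j+t_k)})^{-1}$ for $(s,t)=(s_1,\dots,s_m;t_1,\dots,t_n)\in\mathbb R^{m+n}$. $\Pi_0$ is the set of points of $\mathbb R^{m+n}$ with $t_n=0$ and $-\pi\le s_j,t_k\le\pi$ for all $j,k$, and $ds\,dt$ is Lebesgue measure on the hyperplane $t_n=0$ identified with $\mathbb R^{m+n-1}$. *)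

theory Defs
  imports "HOL-Analysis.Analysis"
begin

text \<open>
  An $m \times n$ matrix is a function on indices \<open>j \<in> {1..m}\<close>, \<open>k \<in> {1..n}\<close>; values at other
  indices are never inspected.
\<close>

definition transportation_polytope ::
    "nat \<Rightarrow> nat \<Rightarrow> (nat \<Rightarrow> nat) \<Rightarrow> (nat \<Rightarrow> nat) \<Rightarrow> (nat \<Rightarrow> nat \<Rightarrow> real) set" where
  "transportation_polytope m n R C =
     {X. (\<forall>j\<in>{1..m}. \<forall>k\<in>{1..n}. 0 \<le> X j k)
       \<and> (\<forall>j\<in>{1..m}. (\<Sum>k=1..n. X j k) = real (R j))
       \<and> (\<forall>k\<in>{1..n}. (\<Sum>j=1..m. X j k) = real (C k))}"

definition matrix_entropy :: "nat \<Rightarrow> nat \<Rightarrow> (nat \<Rightarrow> nat \<Rightarrow> real) \<Rightarrow> real" where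
  "matrix_entropy m n X =
     (\<Sum>j=1..m. \<Sum>k=1..n. (X j k + 1) * ln (X j k + 1) - X j k * ln (X j k))"

text \<open>
  The entropy is strictly concave, so a maximizer on the polytope is unique (as a matrix, i.e. up to
  the values at indices outside \<open>{1..m} \<times> {1..n}\<close>).  The term at a zero entry is
  $1 \ln 1 - 0 \ln 0 = 0$.
\<close>
definition typical_matrix ::
    "nat \<Rightarrow> nat \<Rightarrow> (nat \<Rightarrow> nat) \<Rightarrow> (nat \<Rightarrow> nat) \<Rightarrow> (nat \<Rightarrow> nat \<Rightarrow> real) \<Rightarrow> bool" where
  "typical_matrix m n R C Z \<longleftrightarrow>
     is_arg_max (matrix_entropy m n) (\<lambda>X. X \<in> transportation_polytope m n R C) Z"

text \<open>
  A point \<open>(s, t)\<close> of $\mathbb{R}^{m+n}$ is a function \<open>p\<close> on the disjoint sum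
  \<open>{1..m} <+> {1..n}\<close> (extensional, as in the library's product measures), with
  \<open>s\<^sub>j = p (Inl j)\<close> and \<open>t\<^sub>k = p (Inr k)\<close>.
\<close>
definition F_fun ::
    "nat \<Rightarrow> nat \<Rightarrow> (nat \<Rightarrow> nat) \<Rightarrow> (nat \<Rightarrow> nat) \<Rightarrow> (nat \<Rightarrow> nat \<Rightarrow> real) \<Rightarrow> (nat + nat \<Rightarrow> real) \<Rightarrow> complex"
  where
  "F_fun m n R C Z p =
     exp (- \<i> * of_real (\<Sum>j=1..m. real (R j) * p (Inl j))
          - \<i> * of_real (\<Sum>k=1..n. real (C k) * p (Inr k)))
     * (\<Prod>j=1..m. \<Prod>k=1..n.
          1 / (1 + of_real (Z j k)
                 - of_real (Z j k) * exp (\<i> * of_real (p (Inl j) + p (Inr k)))))"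

text \<open>
  Lebesgue measure on the hyperplane $t_n = 0$: the image of Lebesgue measure on
  $\mathbb{R}^{m+n-1}$ (coordinates \<open>{1..m} <+> {1..<n}\<close>) under the map inserting $t_n = 0$.
\<close>
definition hyperplane_measure :: "nat \<Rightarrow> nat \<Rightarrow> (nat + nat \<Rightarrow> real) measure" where
  "hyperplane_measure m n =
     distr (\<Pi>\<^sub>M i\<in>{1..m} <+> {1..<n}. lborel) (\<Pi>\<^sub>M i\<in>{1..m} <+> {1..n}. borel)
           (\<lambda>p. p(Inr n := 0))"

definition Pi0_set :: "nat \<Rightarrow> nat \<Rightarrow> (nat + nat \<Rightarrow> real) set" where
  "Pi0_set m n = {p \<in> ({1..m} <+> {1..n}) \<rightarrow>\<^sub>E UNIV.
     p (Inr n) = 0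
     \<and> (\<forall>j\<in>{1..m}. - pi \<le> p (Inl j) \<and> p (Inl j) \<le> pi)
     \<and> (\<forall>k\<in>{1..n}. - pi \<le> p (Inr k) \<and> p (Inr k) \<le> pi)}"

definition U_set :: "nat \<Rightarrow> nat \<Rightarrow> real \<Rightarrow> (nat + nat \<Rightarrow> real) set" where
  "U_set m n \<tau> = {p \<in> Pi0_set m n.
     (\<forall>j\<in>{1..m}. \<bar>p (Inl j)\<bar> \<le> ln (real (m + n)) / (\<tau> * sqrt (real (m + n))))
     \<and> (\<forall>k\<in>{1..n}. \<bar>p (Inr k)\<bar> \<le> ln (real (m + n)) / (\<tau> * sqrt (real (m + n))))}"

end

theory Submission
  imports Defs "HOL-Real_Asymp.Real_Asymp"
begin

text \<open>
  Write \<open>|F| = exp (- energy)\<close> and \<open>N = m + n\<close>. Each summand of the energy is comparable, up to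
  constants depending on $\delta$, with \<open>\<phi> (s\<^sub>j + t\<^sub>k)\<close> where \<open>\<phi> u = ln (1 + \<tau>\<^sup>2 (1 - cos u))\<close>, and
  \<open>\<phi> (u + v) \<le> 2 \<phi> u + 2 \<phi> v\<close>. Points whose energy exceeds a large multiple of \<open>N ln N\<close> are
  negligible, since the integral over a box of side of order \<open>1 / (\<tau> N)\<close> about the origin is
  already larger. At any other point some row \<open>j\<^sub>0\<close> has average energy, and with \<open>\<theta> = s\<^sub>j\<^sub>0\<close> the sums
  of \<open>\<phi> (\<theta> + t\<^sub>k)\<close> over \<open>k\<close> and of \<open>\<phi> (s\<^sub>j - \<theta>)\<close> over \<open>j\<close> are both \<open>O (ln N)\<close>. If the point lies
  outside $\mathcal{U}$, then, as \<open>t\<^sub>n = 0\<close>, some coordinate (possibly \<open>t\<^sub>n\<close> itself) is at distance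
  of order \<open>ln N / (\<tau> \<surd>N)\<close> from its centre \<open>\<theta>\<close> or \<open>-\<theta>\<close>; moving it to within \<open>1 / (\<tau> N)\<close> of
  the centre lowers the energy by a multiple of \<open>(ln N)\<^sup>2\<close>, up to \<open>O (ln N)\<close>. Hence \<open>|F|\<close> at the point is at
  most \<open>N\<^sup>-\<^sup>\<kappa>\<^sup>-\<^sup>1\<close> times its average along the line in that coordinate direction, and averaging along a
  line preserves integrals over the torus. Moving \<open>t\<^sub>n\<close> is realised on the hyperplane \<open>t\<^sub>n = 0\<close>
  by the direction \<open>(1, \<dots>, 1; -1, \<dots>, -1)\<close>, along which all other sums \<open>s\<^sub>j + t\<^sub>k\<close> are constant.
\<close>

section \<open>The function bounding the energy\<close>

text \<open>This is the \<phi> of the overview. The factor \<open>\<tau>\<^sup>2\<close> stands in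
  for 2 z (1 + z), with which it is comparable when z lies between \<delta> \<tau> and \<tau> and
  \<tau> is at least \<delta>.\<close>

definition log_dev :: "real \<Rightarrow> real \<Rightarrow> real" where
  "log_dev \<tau> u = ln (1 + \<tau>\<^sup>2 * (1 - cos u))"

lemma log_dev_nonneg: "0 \<le> log_dev \<tau> u"
  unfolding log_dev_def by (intro ln_ge_zero) simp

lemma log_dev_minus [simp]: "log_dev \<tau> (- u) = log_dev \<tau> u"
  by (simp add: log_dev_def)

text \<open>Since 1 - cos x = 2 sin^2 (x/2), this is (A + B)^2 \<le> 2 A^2 + 2 B^2 applied to the
  addition formula for the sine, with the cosines bounded by 1.\<close>

lemma one_minus_cos_add_le:
  "1 - cos (u + v) \<le> 2 * (1 - cos u) + 2 * (1 - cos (v::real))"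
proof -
  have half: "1 - cos x = 2 * (sin (x / 2))\<^sup>2" for x :: real
    using cos_double_sin[of "x / 2"] by simp
  let ?a = "u / 2" and ?b = "v / 2"
  have "(sin (?a + ?b))\<^sup>2 \<le> 2 * (sin ?a * cos ?b)\<^sup>2 + 2 * (cos ?a * sin ?b)\<^sup>2"
    using sum_squares_bound[of "sin ?a * cos ?b" "cos ?a * sin ?b"]
    by (simp add: sin_add power2_sum)
  also have "\<dots> \<le> 2 * (sin ?a)\<^sup>2 + 2 * (sin ?b)\<^sup>2"
    by (intro add_mono mult_left_mono)
       (auto simp: power_mult_distrib abs_square_le_1 intro!: mult_right_le_one_le mult_left_le_one_le)
  finally show ?thesis
    unfolding half by (simp add: add_divide_distrib)
qed

text \<open>Concavity of the logarithm on the segment from 1 to 1 + y, with ln 1 = 0.\<close>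

lemma ln_one_plus_scale_ge:
  assumes "0 \<le> c" "c \<le> 1" "0 \<le> (y::real)"
  shows "c * ln (1 + y) \<le> ln (1 + c * y)"
  using concave_onD[OF ln_concave, of c 1 "1 + y"] assms by (simp add: algebra_simps)

lemma ln_one_plus_scale_le:
  assumes "1 \<le> c" "0 \<le> (y::real)"
  shows "ln (1 + c * y) \<le> c * ln (1 + y)"
  using ln_one_plus_scale_ge[of "1 / c" "c * y"] assms by (simp add: field_simps)

text \<open>A triangle inequality up to the factor 2, behind every later comparison of energies. The
  bound for 1 - cos passes through the logarithm because 1 + a + b \<le> (1 + a) (1 + b) for
  nonnegative a and b; \<open>ln_one_plus_scale_le\<close> then takes the inner factors 2
  out.\<close>

lemma log_dev_add_le: "log_dev \<tau> (u + v) \<le> 2 * log_dev \<tau> u + 2 * log_dev \<tau> v"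
proof -
  let ?y = "\<lambda>x. \<tau>\<^sup>2 * (1 - cos x)"
  have y: "0 \<le> ?y x" for x by simp
  have "?y (u + v) \<le> 2 * ?y u + 2 * ?y v"
    using mult_left_mono[OF one_minus_cos_add_le[of u v], of "\<tau>\<^sup>2"] by (simp add: algebra_simps)
  also have "\<dots> \<le> (1 + 2 * ?y u) * (1 + 2 * ?y v) - 1"
    using mult_nonneg_nonneg[OF y[of u] y[of v]] by (simp add: algebra_simps)
  finally have "log_dev \<tau> (u + v) \<le> ln ((1 + 2 * ?y u) * (1 + 2 * ?y v))"
    unfolding log_dev_def
    by (subst ln_le_cancel_iff) (use y in \<open>auto intro!: mult_pos_pos add_pos_nonneg\<close>)
  also have "\<dots> = ln (1 + 2 * ?y u) + ln (1 + 2 * ?y v)"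
    using y[of u] y[of v] by (intro ln_mult_pos add_pos_nonneg) auto
  also have "\<dots> \<le> 2 * log_dev \<tau> u + 2 * log_dev \<tau> v"
    unfolding log_dev_def by (intro add_mono ln_one_plus_scale_le y) auto
  finally show ?thesis .
qed

lemma one_minus_cos_le: "1 - cos u \<le> u\<^sup>2 / (2::real)"
proof -
  have "(sin (u / 2))\<^sup>2 \<le> (u / 2)\<^sup>2"
    using abs_sin_le_one abs_sin_x_le_abs_x[of "u / 2"] by (metis abs_le_square_iff)
  then show ?thesis using cos_double_sin[of "u / 2"] by (simp add: power_divide)
qed

lemma log_dev_le: "log_dev \<tau> u \<le> \<tau>\<^sup>2 * u\<^sup>2 / 2"
proof -
  have "log_dev \<tau> u \<le> \<tau>\<^sup>2 * (1 - cos u)"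
    unfolding log_dev_def by (intro ln_add_one_self_le_self) simp
  also have "\<dots> \<le> \<tau>\<^sup>2 * (u\<^sup>2 / 2)"
    by (intro mult_left_mono one_minus_cos_le) simp
  finally show ?thesis by simp
qed

text \<open>For 0 \<le> x \<le> 2 the cubic Taylor bound gives sin x \<ge> x - x^3/6 \<ge> x/3. This
  is used at x = |u|/2, which is at most pi/2 < 2.\<close>

lemma one_minus_cos_ge:
  assumes "\<bar>u\<bar> \<le> pi"
  shows "u\<^sup>2 / 18 \<le> 1 - cos u"
proof -
  let ?x = "\<bar>u\<bar> / 2"
  have x: "0 \<le> ?x" "?x \<le> 2" using assms pi_half_less_two by linarith+
  have "\<bar>sin ?x - ?x\<bar> \<le> ?x ^ 3 / 6"
    using Maclaurin_sin_bound[of ?x 3] by (simp add: numeral_3_eq_3 sin_coeff_def fact_numeral)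
  moreover have "?x ^ 3 \<le> 4 * ?x"
    using mult_right_mono[of "?x\<^sup>2" 4 ?x] power_mono[OF x(2,1), of 2] x
    by (simp add: power3_eq_cube power2_eq_square)
  ultimately have "?x / 3 \<le> sin ?x" by linarith
  then have "(?x / 3)\<^sup>2 \<le> (sin ?x)\<^sup>2" using x by (intro power_mono) auto
  moreover have "cos (2 * ?x) = cos u" by (simp add: abs_if)
  ultimately show ?thesis using cos_double_sin[of ?x] by (simp add: power_divide)
qed

text \<open>The bound 9 makes y = \<open>\<tau>\<^sup>2 * b\<^sup>2 / 18\<close> at most 1/2, and
  there ln (1 + y) \<ge> y - y^2 \<ge> y/2.\<close>

lemma log_dev_ge:
  assumes "b < \<bar>u\<bar>" "\<bar>u\<bar> \<le> pi" "0 \<le> b" "\<tau>\<^sup>2 * b\<^sup>2 \<le> 9"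
  shows "\<tau>\<^sup>2 * b\<^sup>2 / 36 \<le> log_dev \<tau> u"
proof -
  let ?y = "\<tau>\<^sup>2 * b\<^sup>2 / 18"
  have "b\<^sup>2 \<le> u\<^sup>2" using assms by (simp add: abs_le_square_iff[symmetric])
  then have "b\<^sup>2 / 18 \<le> 1 - cos u" using one_minus_cos_ge[OF assms(2)] by simp
  then have "?y \<le> \<tau>\<^sup>2 * (1 - cos u)"
    using mult_left_mono[of "b\<^sup>2 / 18" _ "\<tau>\<^sup>2"] by simp
  then have *: "ln (1 + ?y) \<le> log_dev \<tau> u"
    unfolding log_dev_def by (subst ln_le_cancel_iff) (auto intro: add_pos_nonneg)
  have y: "0 \<le> ?y" "?y \<le> 1" and y2: "?y \<le> 1 / 2" using assms by auto
  have "?y / 2 \<le> ?y - ?y\<^sup>2"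
    using mult_left_mono[OF y2 y(1)] unfolding power2_eq_square by linarith
  then have "?y / 2 \<le> ln (1 + ?y)"
    using ln_one_plus_pos_lower_bound[OF y] by linarith
  with * show ?thesis by simp
qed

section \<open>The modulus of \<open>F_fun\<close> and its comparison with
  \<open>log_dev\<close>\<close>

text \<open>The logarithm of |1 + z - z exp (i u)|: the squared modulus is 1 + 2 z (1 + z) (1 - cos
  u), and halving the logarithm takes the root.\<close>

definition energy_term :: "real \<Rightarrow> real \<Rightarrow> real" where
  "energy_term z u = ln (1 + 2 * z * (1 + z) * (1 - cos u)) / 2"

definition energy :: "nat \<Rightarrow> nat \<Rightarrow> (nat \<Rightarrow> nat \<Rightarrow> real) \<Rightarrow> (nat + nat \<Rightarrow> real) \<Rightarrow> real" where
  "energy m n Z p = (\<Sum>j=1..m. \<Sum>k=1..n. energy_term (Z j k) (p (Inl j) + p (Inr k)))"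

lemma cmod_factor:
  assumes "0 \<le> z"
  shows "cmod (1 / (1 + of_real z - of_real z * exp (\<i> * of_real u))) = exp (- energy_term z u)"
proof -
  let ?A = "1 + 2 * z * (1 + z) * (1 - cos u)"
  have A: "?A > 0" using assms by (intro add_pos_nonneg mult_nonneg_nonneg) auto
  have "(cmod (1 + of_real z - of_real z * exp (\<i> * of_real u)))\<^sup>2
      = (1 + z - z * cos u)\<^sup>2 + (z * sin u)\<^sup>2"
    by (simp only: cis_conv_exp[symmetric]) (simp add: cmod_power2)
  also have "\<dots> = (1 + z)\<^sup>2 - 2 * z * (1 + z) * cos u + z\<^sup>2 * ((sin u)\<^sup>2 + (cos u)\<^sup>2)"
    by (simp only: power2_eq_square) algebra
  also have "\<dots> = ?A" by (simp add: power2_eq_square algebra_simps)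
  finally have "cmod (1 + of_real z - of_real z * exp (\<i> * of_real u)) = sqrt ?A"
    by (metis norm_ge_zero real_sqrt_unique)
  also have "\<dots> = exp (energy_term z u)"
    using A by (simp add: energy_term_def ln_sqrt[symmetric])
  finally show ?thesis by (simp add: norm_divide exp_minus inverse_eq_divide)
qed

lemma cmod_F_fun:
  assumes "\<forall>j\<in>{1..m}. \<forall>k\<in>{1..n}. 0 \<le> Z j k"
  shows "cmod (F_fun m n R C Z p) = exp (- energy m n Z p)"
proof -
  have "cmod (F_fun m n R C Z p) = (\<Prod>j=1..m. \<Prod>k=1..n. 
     cmod (1 / (1 + of_real (Z j k) - of_real (Z j k) * exp (\<i> * of_real (p (Inl j) + p (Inr k))))))"
    by (simp add: F_fun_def norm_mult prod_norm[symmetric])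
  also have "\<dots> = (\<Prod>j=1..m. \<Prod>k=1..n. exp (- energy_term (Z j k) (p (Inl j) + p (Inr k))))"
    by (intro prod.cong refl cmod_factor) (use assms in auto)
  also have "\<dots> = exp (- energy m n Z p)"
    by (simp add: energy_def exp_sum sum_negf[symmetric])
  finally show ?thesis .
qed

text \<open>2 z (1 + z) is at least (\<delta> \<tau>)^2, and by concavity the factor \<delta>^2 < 1
  comes out of the logarithm.\<close>

lemma energy_term_lower:
  assumes "0 < \<delta>" "\<delta> < 1" "\<delta> \<le> \<tau>" "\<delta> * \<tau> \<le> z"
  shows "\<delta>\<^sup>2 / 2 * log_dev \<tau> u \<le> energy_term z u"
proof -
  let ?y = "\<tau>\<^sup>2 * (1 - cos u)"
  have "0 \<le> \<delta> * \<tau>" using assms by simp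
  then have z: "0 \<le> \<delta> * \<tau>" "0 \<le> z" using assms(4) by linarith+
  have "\<delta>\<^sup>2 * \<tau>\<^sup>2 = (\<delta> * \<tau>) * (\<delta> * \<tau>)" by (simp add: power2_eq_square)
  also have "\<dots> \<le> z * (1 + z)" using assms z by (intro mult_mono) auto
  also have "\<dots> \<le> 2 * z * (1 + z)" using z by simp
  finally have "\<delta>\<^sup>2 * \<tau>\<^sup>2 * (1 - cos u) \<le> 2 * z * (1 + z) * (1 - cos u)"
    by (rule mult_right_mono) simp
  then have "\<delta>\<^sup>2 * ?y \<le> 2 * z * (1 + z) * (1 - cos u)" by (simp only: mult.assoc)
  then have "ln (1 + \<delta>\<^sup>2 * ?y) \<le> ln (1 + 2 * z * (1 + z) * (1 - cos u))"
    using z by (subst ln_le_cancel_iff) (auto intro!: add_pos_nonneg)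
  moreover have "\<delta>\<^sup>2 * ln (1 + ?y) \<le> ln (1 + \<delta>\<^sup>2 * ?y)"
    using assms by (intro ln_one_plus_scale_ge) (auto simp: power_le_one)
  ultimately show ?thesis by (simp add: energy_term_def log_dev_def)
qed

text \<open>The lower bound on \<tau> enters here: \<tau> \<le> \<tau>^2 / \<delta> gives \<tau> (1
  + \<tau>) \<le> (1 + 1/\<delta>) \<tau>^2.\<close>

lemma energy_term_upper:
  assumes "0 < \<delta>" "\<delta> \<le> \<tau>" "0 \<le> z" "z \<le> \<tau>"
  shows "energy_term z u \<le> (1 + 1 / \<delta>) * log_dev \<tau> u"
proof -
  let ?y = "\<tau>\<^sup>2 * (1 - cos u)" and ?c = "2 * (1 + 1 / \<delta>)"
  have c: "1 \<le> ?c" using assms by simp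
  have "z * (1 + z) \<le> \<tau> * (1 + \<tau>)" using assms by (intro mult_mono) auto
  also have "\<dots> \<le> (1 + 1 / \<delta>) * \<tau>\<^sup>2"
    using assms mult_left_mono[of \<delta> \<tau> \<tau>] by (simp add: field_simps power2_eq_square)
  finally have "z * (1 + z) * (2 * (1 - cos u)) \<le> (1 + 1 / \<delta>) * \<tau>\<^sup>2 * (2 * (1 - cos u))"
    by (rule mult_right_mono) simp
  then have "2 * z * (1 + z) * (1 - cos u) \<le> ?c * ?y" by (simp only: mult_ac)
  then have "ln (1 + 2 * z * (1 + z) * (1 - cos u)) \<le> ln (1 + ?c * ?y)"
    using assms c by (subst ln_le_cancel_iff) (auto intro!: add_pos_nonneg mult_nonneg_nonneg)
  also have "\<dots> \<le> ?c * ln (1 + ?y)" by (intro ln_one_plus_scale_le c) simp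
  finally show ?thesis unfolding energy_term_def log_dev_def by linarith
qed

section \<open>A centre for points of low energy, and the gain from moving towards it\<close>

text \<open>Some row has at most the average sum, which is at most D A because m + n \<le> D m. For
  the differences, s_j - s_j0 = (s_j + t_k) - (s_j0 + t_k) for every k; summing the quasi-triangle
  inequality over j and k and dividing by n leaves 2 D A + 2 D^2 A.\<close>

lemma center_exists:
  fixes s t :: "nat \<Rightarrow> real"
  assumes "0 < m" "0 < n" and Dm: "real (m + n) \<le> D * m" and Dn: "real (m + n) \<le> D * n"
    and S: "(\<Sum>j=1..m. \<Sum>k=1..n. log_dev \<tau> (s j + t k)) \<le> A * real (m + n)"
  obtains j0 where "j0 \<in> {1..m}" "(\<Sum>k=1..n. log_dev \<tau> (s j0 + t k)) \<le> 4 * D\<^sup>2 * A"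
    "(\<Sum>j=1..m. log_dev \<tau> (s j - s j0)) \<le> 4 * D\<^sup>2 * A"
proof -
  let ?f = "\<lambda>j. \<Sum>k=1..n. log_dev \<tau> (s j + t k)" and ?S = "\<Sum>j=1..m. \<Sum>k=1..n. log_dev \<tau> (s j + t k)"
  have S0: "0 \<le> ?S" by (intro sum_nonneg log_dev_nonneg)
  have A: "0 \<le> A" using order_trans[OF S0 S] \<open>0 < m\<close> by (simp add: zero_le_mult_iff)
  have D: "1 \<le> D"
  proof (rule ccontr)
    assume "\<not> 1 \<le> D"
    then have "D * m \<le> 1 * real m" by (intro mult_right_mono) auto
    then show False using Dm \<open>0 < n\<close> by simp
  qed
  have "\<exists>j0\<in>{1..m}. ?f j0 \<le> D * A"
  proof (rule ccontr)
    assume "\<not> ?thesis"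
    then have "(\<Sum>j=1..m. D * A) < ?S" using \<open>0 < m\<close> by (intro sum_strict_mono) (auto simp: not_le)
    moreover have "A * real (m + n) \<le> A * (D * m)" using Dm A by (intro mult_left_mono)
    ultimately show False using S by (simp add: algebra_simps)
  qed
  then obtain j0 where j0: "j0 \<in> {1..m}" "?f j0 \<le> D * A" by blast
  have "D * A \<le> 4 * D\<^sup>2 * A"
    using A D mult_right_mono[of D "4 * D\<^sup>2" A] self_le_power[of D 2] by simp
  have "real n * (\<Sum>j=1..m. log_dev \<tau> (s j - s j0))
      = (\<Sum>j=1..m. \<Sum>k=1..n. log_dev \<tau> (s j - s j0))"
    by (simp add: sum_distrib_left)
  also have "\<dots> \<le> (\<Sum>j=1..m. \<Sum>k=1..n. 2 * log_dev \<tau> (s j + t k) + 2 * log_dev \<tau> (s j0 + t k))"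
  proof (intro sum_mono)
    fix j k
    show "log_dev \<tau> (s j - s j0) \<le> 2 * log_dev \<tau> (s j + t k) + 2 * log_dev \<tau> (s j0 + t k)"
      using log_dev_add_le[of \<tau> "s j + t k" "- (s j0 + t k)"] by (simp only: log_dev_minus) simp
  qed
  also have "\<dots> = 2 * ?S + 2 * m * ?f j0"
    by (simp add: sum.distrib sum_distrib_left mult_ac)
  also have "\<dots> \<le> 2 * (A * (D * n)) + 2 * (D * n) * (D * A)"
  proof (intro add_mono mult_mono mult_left_mono j0(2))
    show "?S \<le> A * (D * n)" using S mult_left_mono[OF Dn A] by linarith
  qed (use D A Dn in \<open>auto intro!: sum_nonneg log_dev_nonneg\<close>)
  also have "\<dots> \<le> real n * (4 * D\<^sup>2 * A)"
  proof -
    have "D * A \<le> D\<^sup>2 * A" using A D mult_right_mono[of D "D\<^sup>2" A] self_le_power[of D 2] by simp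
    then have "real n * (2 * (D * A) + 2 * (D\<^sup>2 * A)) \<le> real n * (4 * D\<^sup>2 * A)"
      by (intro mult_left_mono) linarith+
    then show ?thesis by (simp add: algebra_simps power2_eq_square)
  qed
  finally have "(\<Sum>j=1..m. log_dev \<tau> (s j - s j0)) \<le> 4 * D\<^sup>2 * A"
    using \<open>0 < n\<close> by simp
  with j0 \<open>D * A \<le> _\<close> show ?thesis by (intro that[of j0]) auto
qed

text \<open>The effect on one row or column of moving its coordinate from x to \<theta> + y, where
  the \<open>r a\<close> are the opposite coordinates. The old energy is large since x - \<theta> =
  (x + r a) - (\<theta> + r a) and the terms at \<theta> + r a sum to at most L. The new energy is
  small since \<theta> + y + r a differs from \<theta> + r a only by y, whose total cost is the
  summand 1.\<close>

lemma recentering_gain: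
  fixes w :: "'a \<Rightarrow> real \<Rightarrow> real"
  fixes \<Psi> :: real
  assumes "finite A"
    and low: "\<And>a u. a \<in> A \<Longrightarrow> c * log_dev \<tau> u \<le> w a u"
    and up: "\<And>a u. a \<in> A \<Longrightarrow> w a u \<le> d * log_dev \<tau> u"
    and c: "0 \<le> c" and d: "0 \<le> d"
    and L: "(\<Sum>a\<in>A. log_dev \<tau> (\<theta> + r a)) \<le> L"
    and \<Psi>: "\<Psi> \<le> log_dev \<tau> (x - \<theta>)"
    and y: "card A * log_dev \<tau> y \<le> 1 / 2"
  shows "c * (card A * \<Psi> / 2 - L) - d * (2 * L + 1) \<le> (\<Sum>a\<in>A. w a (x + r a)) - (\<Sum>a\<in>A. w a (\<theta> + y + r a))"
proof -
  have "card A * \<Psi> \<le> (\<Sum>a\<in>A. log_dev \<tau> (x - \<theta>))" using \<Psi> by (simp add: mult_left_mono)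
  also have "\<dots> \<le> (\<Sum>a\<in>A. 2 * log_dev \<tau> (x + r a) + 2 * log_dev \<tau> (\<theta> + r a))"
  proof (intro sum_mono)
    fix a
    show "log_dev \<tau> (x - \<theta>) \<le> 2 * log_dev \<tau> (x + r a) + 2 * log_dev \<tau> (\<theta> + r a)"
      using log_dev_add_le[of \<tau> "x + r a" "- (\<theta> + r a)"] by (simp only: log_dev_minus) simp
  qed
  also have "\<dots> \<le> 2 * (\<Sum>a\<in>A. log_dev \<tau> (x + r a)) + 2 * L"
    using L by (simp add: sum.distrib sum_distrib_left[symmetric])
  finally have "card A * \<Psi> / 2 - L \<le> (\<Sum>a\<in>A. log_dev \<tau> (x + r a))" by simp
  then have "c * (card A * \<Psi> / 2 - L) \<le> c * (\<Sum>a\<in>A. log_dev \<tau> (x + r a))"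
    using c by (rule mult_left_mono)
  also have "\<dots> \<le> (\<Sum>a\<in>A. w a (x + r a))"
    unfolding sum_distrib_left by (intro sum_mono low)
  finally have 1: "c * (card A * \<Psi> / 2 - L) \<le> (\<Sum>a\<in>A. w a (x + r a))" .
  have "(\<Sum>a\<in>A. w a (\<theta> + y + r a)) \<le> (\<Sum>a\<in>A. d * (2 * log_dev \<tau> (\<theta> + r a) + 2 * log_dev \<tau> y))"
  proof (intro sum_mono)
    fix a assume "a \<in> A"
    have "log_dev \<tau> (\<theta> + y + r a) \<le> 2 * log_dev \<tau> (\<theta> + r a) + 2 * log_dev \<tau> y"
      using log_dev_add_le[of \<tau> "\<theta> + r a" y] by (simp add: algebra_simps)
    then show "w a (\<theta> + y + r a) \<le> d * (2 * log_dev \<tau> (\<theta> + r a) + 2 * log_dev \<tau> y)"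
      using up[OF \<open>a \<in> A\<close>, of "\<theta> + y + r a"] d mult_left_mono by (meson order_trans)
  qed
  also have "\<dots> = d * (2 * (\<Sum>a\<in>A. log_dev \<tau> (\<theta> + r a)) + 2 * (card A * log_dev \<tau> y))"
    by (simp add: sum_distrib_left[symmetric] sum.distrib)
  also have "\<dots> \<le> d * (2 * L + 1)"
    using L y by (intro mult_left_mono d) auto
  finally show ?thesis using 1 by simp
qed

section \<open>Averaging periodic functions along lines\<close>

text \<open>Reduce v modulo the period to w in [0, 2 pi), translate the window by w, cut it at pi,
  and bring the overhang back by one period.\<close>

lemma nn_integral_periodic_shift:
  fixes g :: "real \<Rightarrow> ennreal"
  assumes [measurable]: "g \<in> borel_measurable borel" and per: "\<And>x. g (x + 2 * pi) = g x"
  shows "(\<integral>\<^sup>+x. g (x + v) * indicator {-pi..pi} x \<partial>lborel) = (\<integral>\<^sup>+x. g x * indicator {-pi..pi} x \<partial>lborel)"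
proof -
  interpret periodic_fun_simple g "2 * pi"
    by unfold_locales (fact per)
  define k where "k = \<lfloor>v / (2 * pi)\<rfloor>"
  define w where "w = v - of_int k * (2 * pi)"
  have "of_int k \<le> v / (2 * pi)" "v / (2 * pi) < of_int k + 1"
    by (simp_all add: k_def)
  then have w: "0 \<le> w" "w < 2 * pi"
    by (simp_all add: w_def field_simps)
  have gv: "g (x + v) = g (x + w)" for x
    using plus_of_int[of "x + w" k] by (simp add: w_def)
  \<comment> \<open>Half-open intervals make the translated pieces fit together without overlap; the
    endpoint pi is a null set.\<close>
  have co: "AE x in lborel. indicator {-pi..pi} x = (indicator {-pi..<pi} x :: ennreal)"
    using AE_lborel_singleton[of pi] by eventually_elim (auto simp: indicator_def)
  have tr: "(\<integral>\<^sup>+x. h (x + c) \<partial>lborel) = (\<integral>\<^sup>+x. h x \<partial>lborel)"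
    if [measurable]: "h \<in> borel_measurable borel" for h :: "real \<Rightarrow> ennreal" and c
    using nn_integral_real_affine[of h 1 c] by (simp add: add.commute)
  have "(\<integral>\<^sup>+x. g (x + v) * indicator {-pi..pi} x \<partial>lborel)
      = (\<integral>\<^sup>+x. g (x + w) * indicator {-pi..<pi} x \<partial>lborel)"
    using co by (intro nn_integral_cong_AE) (auto simp: gv elim!: eventually_mono)
  also have "\<dots> = (\<integral>\<^sup>+x. g (x + w) * indicator {-pi + w..<pi + w} (x + w) \<partial>lborel)"
    by (intro nn_integral_cong) (auto simp: indicator_def)
  also have "\<dots> = (\<integral>\<^sup>+x. g x * indicator {-pi + w..<pi + w} x \<partial>lborel)"
    by (rule tr) measurable
  also have "\<dots> = (\<integral>\<^sup>+x. g x * indicator {-pi + w..<pi} x + g x * indicator {pi..<pi + w} x \<partial>lborel)"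
    using w by (intro nn_integral_cong) (auto simp: indicator_def)
  also have "\<dots> = (\<integral>\<^sup>+x. g x * indicator {-pi + w..<pi} x \<partial>lborel)
      + (\<integral>\<^sup>+x. g x * indicator {pi..<pi + w} x \<partial>lborel)"
    by (rule nn_integral_add) measurable
  also have "(\<integral>\<^sup>+x. g x * indicator {pi..<pi + w} x \<partial>lborel)
      = (\<integral>\<^sup>+x. g (x + 2 * pi) * indicator {pi..<pi + w} (x + 2 * pi) \<partial>lborel)"
    by (rule tr[symmetric]) measurable
  also have "\<dots> = (\<integral>\<^sup>+x. g x * indicator {-pi..<-pi + w} x \<partial>lborel)"
    by (intro nn_integral_cong) (auto simp: per indicator_def)
  also have "(\<integral>\<^sup>+x. g x * indicator {-pi + w..<pi} x \<partial>lborel) + \<dots>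
      = (\<integral>\<^sup>+x. g x * indicator {-pi + w..<pi} x + g x * indicator {-pi..<-pi + w} x \<partial>lborel)"
    by (rule nn_integral_add[symmetric]) measurable
  also have "\<dots> = (\<integral>\<^sup>+x. g x * indicator {-pi..<pi} x \<partial>lborel)"
    using w by (intro nn_integral_cong) (auto simp: indicator_def)
  also have "\<dots> = (\<integral>\<^sup>+x. g x * indicator {-pi..pi} x \<partial>lborel)"
    using co by (intro nn_integral_cong_AE) (auto elim!: eventually_mono)
  finally show ?thesis .
qed

text \<open>Restricting the result to \<open>I\<close> keeps it in the space of the product measure
  over \<open>I\<close>.\<close>

definition shift :: "'i set \<Rightarrow> ('i \<Rightarrow> real) \<Rightarrow> ('i \<Rightarrow> real) \<Rightarrow> 'i \<Rightarrow> real" where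
  "shift I v p = (\<lambda>i\<in>I. p i + v i)"

lemma measurable_shift [measurable]:
  "shift I v \<in> measurable (\<Pi>\<^sub>M i\<in>I. lborel) (\<Pi>\<^sub>M i\<in>I. lborel)"
  unfolding shift_def by measurable

text \<open>Induction on the coordinates. Fubini isolates coordinate \<open>i\<close>; the
  one-dimensional lemma removes its shift inside the inner integral \<open>H\<close>, and
  \<open>H\<close> is again periodic in the remaining coordinates, so the induction hypothesis
  removes the other shifts.\<close>

lemma nn_integral_torus_shift:
  fixes G :: "('i \<Rightarrow> real) \<Rightarrow> ennreal"
  assumes "finite I" "G \<in> borel_measurable (\<Pi>\<^sub>M i\<in>I. lborel)"
    and "\<And>p i. p \<in> extensional I \<Longrightarrow> i \<in> I \<Longrightarrow> G (p(i := p i + 2 * pi)) = G p"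
  shows "(\<integral>\<^sup>+p. G (shift I v p) * indicator (\<Pi>\<^sub>E i\<in>I. {-pi..pi}) p \<partial>(\<Pi>\<^sub>M i\<in>I. lborel))
       = (\<integral>\<^sup>+p. G p * indicator (\<Pi>\<^sub>E i\<in>I. {-pi..pi}) p \<partial>(\<Pi>\<^sub>M i\<in>I. lborel))"
  using assms
proof (induction I arbitrary: G rule: finite_induct)
  case empty
  have "shift {} v p = p" if "p \<in> extensional {}" for p
    using that by (auto simp: shift_def extensional_def)
  then show ?case
    by (intro nn_integral_cong) (simp add: space_PiM PiE_def)
next
  case (insert i I)
  interpret product_sigma_finite "\<lambda>_::'i. lborel :: real measure" ..
  note [measurable] = insert.prems(1)
  let ?M = "\<Pi>\<^sub>M i\<in>I. lborel :: real measure" and ?Q = "\<lambda>I. \<Pi>\<^sub>E i\<in>I. {-pi..pi}"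
  have Q [measurable]: "?Q J \<in> sets (\<Pi>\<^sub>M i\<in>J. lborel)" if "finite J" for J :: "'i set"
    using that by (intro sets_PiM_I_finite) auto
  have [measurable]: "finite I" "finite (insert i I)" using insert.hyps by auto
  define H where "H p = (\<integral>\<^sup>+y. G (p(i := y)) * indicator {-pi..pi} y \<partial>lborel)" for p
  have Gm: "(\<lambda>(p, y). G (p(i := y))) \<in> borel_measurable (?M \<Otimes>\<^sub>M lborel)"
    using measurable_compose[OF measurable_add_dim insert.prems(1)] by (simp add: case_prod_beta')
  then have Hm: "H \<in> borel_measurable ?M"
    unfolding H_def using sigma_finite_lborel
    by (intro sigma_finite_measure.borel_measurable_nn_integral) (auto simp: case_prod_beta')
  have Gi: "(\<lambda>y. G (p(i := y))) \<in> borel_measurable borel" if "p \<in> space ?M" for p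
    using measurable_compose[OF measurable_Pair1'[OF that, of "lborel"] Gm] by simp
  have ind: "indicator (?Q (insert i I)) (p(i := y)) = (indicator (?Q I) p * indicator {-pi..pi} y :: ennreal)"
    if "p \<in> space ?M" for p y
    using that insert.hyps
    by (auto simp: indicator_def space_PiM PiE_def Pi_def extensional_def split: if_splits)
  have fub: "(\<integral>\<^sup>+p. F p * indicator (?Q (insert i I)) p \<partial>(\<Pi>\<^sub>M i\<in>insert i I. lborel))
     = (\<integral>\<^sup>+p. (\<integral>\<^sup>+y. F (p(i := y)) * indicator {-pi..pi} y \<partial>lborel) * indicator (?Q I) p \<partial>?M)"
    if [measurable]: "F \<in> borel_measurable (\<Pi>\<^sub>M i\<in>insert i I. lborel)" for F :: "('i \<Rightarrow> real) \<Rightarrow> ennreal"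
  proof -
    have Fm: "(\<lambda>(p, y). F (p(i := y))) \<in> borel_measurable (?M \<Otimes>\<^sub>M lborel)"
      using measurable_compose[OF measurable_add_dim that] by (simp add: case_prod_beta')
    have Fi [measurable]: "(\<lambda>y. F (p(i := y))) \<in> borel_measurable borel" if "p \<in> space ?M" for p
      using measurable_compose[OF measurable_Pair1'[OF that, of "lborel"] Fm] by simp
    have "(\<integral>\<^sup>+p. F p * indicator (?Q (insert i I)) p \<partial>(\<Pi>\<^sub>M i\<in>insert i I. lborel))
      = (\<integral>\<^sup>+p. (\<integral>\<^sup>+y. F (p(i := y)) * indicator (?Q (insert i I)) (p(i := y)) \<partial>lborel) \<partial>?M)"
      using insert.hyps by (intro product_nn_integral_insert) measurable
    also have "\<dots> = (\<integral>\<^sup>+p. (\<integral>\<^sup>+y. (F (p(i := y)) * indicator {-pi..pi} y) * indicator (?Q I) p \<partial>lborel) \<partial>?M)"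
      by (intro nn_integral_cong) (simp add: ind mult_ac)
    also have "\<dots> = (\<integral>\<^sup>+p. (\<integral>\<^sup>+y. F (p(i := y)) * indicator {-pi..pi} y \<partial>lborel) * indicator (?Q I) p \<partial>?M)"
      by (intro nn_integral_cong nn_integral_multc) measurable
    finally show ?thesis .
  qed
  have sh: "shift (insert i I) v (p(i := y)) = (shift I v p)(i := y + v i)" for p y
    using insert.hyps by (auto simp: shift_def fun_eq_iff)
  have "(\<integral>\<^sup>+p. G (shift (insert i I) v p) * indicator (?Q (insert i I)) p \<partial>(\<Pi>\<^sub>M i\<in>insert i I. lborel))
      = (\<integral>\<^sup>+p. (\<integral>\<^sup>+y. G ((shift I v p)(i := y + v i)) * indicator {-pi..pi} y \<partial>lborel) * indicator (?Q I) p \<partial>?M)"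
    by (subst fub) (auto simp: sh)
  also have "\<dots> = (\<integral>\<^sup>+p. H (shift I v p) * indicator (?Q I) p \<partial>?M)"
  proof (intro nn_integral_cong arg_cong2[of _ _ _ _ "(*)"] refl)
    fix p assume "p \<in> space ?M"
    then have s: "shift I v p \<in> space ?M" by (simp add: shift_def space_PiM)
    show "(\<integral>\<^sup>+y. G ((shift I v p)(i := y + v i)) * indicator {-pi..pi} y \<partial>lborel) = H (shift I v p)"
      unfolding H_def
    proof (rule nn_integral_periodic_shift)
      show "(\<lambda>y. G ((shift I v p)(i := y))) \<in> borel_measurable borel" by (rule Gi[OF s])
      have "(shift I v p)(i := x) \<in> extensional (insert i I)" for x
        using s by (auto simp: space_PiM PiE_def extensional_def)
      from insert.prems(2)[OF this insertI1]
      show "G ((shift I v p)(i := x + 2 * pi)) = G ((shift I v p)(i := x))" for x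
        by (simp only: fun_upd_upd fun_upd_same)
    qed
  qed
  also have "\<dots> = (\<integral>\<^sup>+p. H p * indicator (?Q I) p \<partial>?M)"
  proof (rule insert.IH[OF Hm])
    fix p :: "'i \<Rightarrow> real" and j assume p: "p \<in> extensional I" and j: "j \<in> I"
    then have "j \<noteq> i" using insert.hyps by auto
    have "G (p(j := p j + 2 * pi, i := y)) = G (p(i := y))" for y
    proof -
      have "p(i := y) \<in> extensional (insert i I)" using p by (simp add: extensional_def)
      from insert.prems(2)[OF this insertI2[OF j]]
      have "G (p(i := y, j := (p(i := y)) j + 2 * pi)) = G (p(i := y))" .
      also have "p(i := y, j := (p(i := y)) j + 2 * pi) = p(j := p j + 2 * pi, i := y)"
        using \<open>j \<noteq> i\<close> by (auto simp: fun_eq_iff)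
      finally show ?thesis .
    qed
    then show "H (p(j := p j + 2 * pi)) = H p" by (simp add: H_def)
  qed
  also have "\<dots> = (\<integral>\<^sup>+p. G p * indicator (?Q (insert i I)) p \<partial>(\<Pi>\<^sub>M i\<in>insert i I. lborel))"
    unfolding H_def by (rule fub[symmetric]) measurable
  finally show ?case .
qed

text \<open>After exchanging the integrals, each fixed x gives a translation by x v, under which the
  torus integral is invariant. Hence neither v nor the window [-a, a] has to be related to the
  period.\<close>

lemma nn_integral_torus_line_average:
  fixes G :: "('i \<Rightarrow> real) \<Rightarrow> ennreal"
  assumes I: "finite I" and G [measurable]: "G \<in> borel_measurable (\<Pi>\<^sub>M i\<in>I. lborel)"
    and per: "\<And>p i. p \<in> extensional I \<Longrightarrow> i \<in> I \<Longrightarrow> G (p(i := p i + 2 * pi)) = G p"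
    and a: "0 \<le> a"
  shows "(\<integral>\<^sup>+p. (\<integral>\<^sup>+x. G (shift I (\<lambda>i. x * v i) p) * indicator {-a..a} x \<partial>lborel)
              * indicator (\<Pi>\<^sub>E i\<in>I. {-pi..pi}) p \<partial>(\<Pi>\<^sub>M i\<in>I. lborel))
       = ennreal (2 * a) * (\<integral>\<^sup>+p. G p * indicator (\<Pi>\<^sub>E i\<in>I. {-pi..pi}) p \<partial>(\<Pi>\<^sub>M i\<in>I. lborel))"
    (is "?lhs = _ * ?J")
proof -
  interpret product_sigma_finite "\<lambda>_::'i. lborel :: real measure" ..
  let ?M = "\<Pi>\<^sub>M i\<in>I. lborel :: real measure" and ?Q = "\<Pi>\<^sub>E i\<in>I. {-pi..pi}"
  interpret pair_sigma_finite ?M "lborel :: real measure"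
    by (intro pair_sigma_finite.intro sigma_finite I sigma_finite_lborel)
  have [measurable]: "?Q \<in> sets ?M" using I by (intro sets_PiM_I_finite) auto
  have sm [measurable]: "(\<lambda>z. shift I (\<lambda>i. snd z * v i) (fst z)) \<in> measurable (?M \<Otimes>\<^sub>M lborel) ?M"
    unfolding shift_def by measurable
  have Gs [measurable]: "(\<lambda>z. G (shift I (\<lambda>i. snd z * v i) (fst z))) \<in> borel_measurable (?M \<Otimes>\<^sub>M lborel)"
    using measurable_compose[OF sm G] .
  have Gx [measurable]: "(\<lambda>x. G (shift I (\<lambda>i. x * v i) p)) \<in> borel_measurable borel" if "p \<in> space ?M" for p
    using measurable_compose[OF measurable_Pair1'[OF that, of lborel] Gs] by simp
  have "?lhs = (\<integral>\<^sup>+p. (\<integral>\<^sup>+x. G (shift I (\<lambda>i. x * v i) p) * indicator ?Q p * indicator {-a..a} x \<partial>lborel) \<partial>?M)"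
    by (intro nn_integral_cong) (subst nn_integral_multc[symmetric], auto simp: mult_ac)
  also have "\<dots> = (\<integral>\<^sup>+x. (\<integral>\<^sup>+p. G (shift I (\<lambda>i. x * v i) p) * indicator ?Q p * indicator {-a..a} x \<partial>?M) \<partial>lborel)"
    by (rule Fubini'[symmetric]) (simp add: case_prod_beta', measurable)
  also have "\<dots> = (\<integral>\<^sup>+x. ?J * indicator {-a..a} x \<partial>lborel)"
    by (intro nn_integral_cong, subst nn_integral_multc) (auto simp: nn_integral_torus_shift[OF I G per])
  also have "\<dots> = ennreal (2 * a) * ?J"
    using a by (subst nn_integral_cmult_indicator) (auto simp: mult.commute)
  finally show ?thesis .
qed

lemma emeasure_PiM_cube:
  assumes "finite I" "0 \<le> a"
  shows "emeasure (\<Pi>\<^sub>M i\<in>I. lborel) (\<Pi>\<^sub>E i\<in>I. {-a..a}) = ennreal ((2 * a) ^ card I)"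
proof -
  interpret product_sigma_finite "\<lambda>_::'i. lborel :: real measure" ..
  show ?thesis using assms by (subst emeasure_PiM) (auto simp: ennreal_power)
qed

section \<open>Descent of the energy outside the central box\<close>

lemma energy_diff_Inl:
  assumes "j \<in> {1..m}"
  shows "energy m n Z p - energy m n Z (p(Inl j := y))
    = (\<Sum>k=1..n. energy_term (Z j k) (p (Inl j) + p (Inr k)))
      - (\<Sum>k=1..n. energy_term (Z j k) (y + p (Inr k)))"
proof -
  have "energy m n Z p - energy m n Z (p(Inl j := y))
    = (\<Sum>j'=1..m. if j' = j then \<Sum>k=1..n. energy_term (Z j k) (p (Inl j) + p (Inr k))
        - energy_term (Z j k) (y + p (Inr k)) else 0)"
    unfolding energy_def sum_subtractf[symmetric] by (intro sum.cong) auto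
  then show ?thesis using assms by (simp add: sum_subtractf)
qed

lemma energy_diff_Inr:
  assumes "k \<in> {1..n}"
  shows "energy m n Z p - energy m n Z (p(Inr k := y))
    = (\<Sum>j=1..m. energy_term (Z j k) (p (Inr k) + p (Inl j)))
      - (\<Sum>j=1..m. energy_term (Z j k) (y + p (Inl j)))"
proof -
  have "energy m n Z p - energy m n Z (p(Inr k := y))
    = (\<Sum>j=1..m. \<Sum>k'=1..n. if k' = k then energy_term (Z j k) (p (Inr k) + p (Inl j))
        - energy_term (Z j k) (y + p (Inl j)) else 0)"
    unfolding energy_def sum_subtractf[symmetric] by (intro sum.cong) (auto simp: add.commute)
  then show ?thesis using assms by (simp add: sum_subtractf)
qed

text \<open>The energy bound yields a centre \<theta>: row coordinates should lie near \<theta> and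
  column coordinates near -\<theta>. A coordinate that is far from its centre is moved to within y
  of it; x is the displacement to the centre itself. The bound on |x| later confines the move to a
  fixed window, and having the same x for all small y makes the gain hold on a whole
  interval.\<close>

lemma descent_coordinate:
  fixes \<delta> :: real
  defines "D \<equiv> 1 + 1 / \<delta>"
  assumes \<delta>: "0 < \<delta>" "\<delta> < 1" and "0 < m" "0 < n"
    and mn: "\<delta> * real n \<le> real m" "\<delta> * real m \<le> real n"
    and \<tau>: "\<delta> \<le> \<tau>"
    and Z: "\<And>j k. j \<in> {1..m} \<Longrightarrow> k \<in> {1..n} \<Longrightarrow> \<delta> * \<tau> \<le> Z j k \<and> Z j k \<le> \<tau>"
    and b: "0 \<le> b" "\<tau>\<^sup>2 * b\<^sup>2 \<le> 9"
    and q0: "q (Inr n) = 0" and qpi: "\<And>i. i \<in> {1..m} <+> {1..n} \<Longrightarrow> \<bar>q i\<bar> \<le> pi"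
    and far: "l \<in> {1..m} <+> {1..n}" "b < \<bar>q l\<bar>"
    and en: "energy m n Z q \<le> \<delta>\<^sup>2 / 2 * A * real (m + n)"
  obtains i x where "i \<in> {1..m} <+> {1..n}" "\<bar>x\<bar> \<le> 2 * pi"
    "\<And>y. \<bar>y\<bar> \<le> 1 / (\<tau> * real (m + n)) \<Longrightarrow>
      \<delta>\<^sup>2 / 2 * (real (m + n) / D * (\<tau>\<^sup>2 * b\<^sup>2 / 144) / 2 - 4 * D\<^sup>2 * A) - D * (2 * (4 * D\<^sup>2 * A) + 1)
      \<le> energy m n Z q - energy m n Z (q(i := q i + (x + y)))"
proof -
  let ?N = "real (m + n)" and ?L = "4 * D\<^sup>2 * A"
  \<comment> \<open>A quarter of the lower bound from \<open>log_dev_ge\<close>: two distances below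
    \<Psi> combine to less than 4 \<Psi>.\<close>
  define \<Psi> where "\<Psi> = \<tau>\<^sup>2 * b\<^sup>2 / 144"
  let ?gain = "\<delta>\<^sup>2 / 2 * (?N / D * \<Psi> / 2 - ?L) - D * (2 * ?L + 1)"
  have D: "1 \<le> D" "0 < D" using \<delta> by (auto simp: D_def add_pos_pos)
  have Dmn: "?N \<le> D * m" "?N \<le> D * n"
    using mn \<delta> by (simp_all add: D_def field_simps)
  have \<tau>0: "0 < \<tau>" using \<delta> \<tau> by simp
  have N: "1 \<le> ?N" using \<open>0 < m\<close> by simp
  have \<Psi>0: "0 \<le> \<Psi>" by (simp add: \<Psi>_def)
  have z0: "0 \<le> Z j k" if "j \<in> {1..m}" "k \<in> {1..n}" for j k
    using Z[OF that] \<delta> \<tau>0 by (meson mult_nonneg_nonneg less_imp_le order_trans)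
  have low: "\<delta>\<^sup>2 / 2 * log_dev \<tau> u \<le> energy_term (Z j k) u" if "j \<in> {1..m}" "k \<in> {1..n}" for j k u
    using Z[OF that] by (intro energy_term_lower \<delta> \<tau>) auto
  have up: "energy_term (Z j k) u \<le> D * log_dev \<tau> u" if "j \<in> {1..m}" "k \<in> {1..n}" for j k u
    unfolding D_def using Z[OF that] z0[OF that] by (intro energy_term_upper \<delta> \<tau>) auto
  have "\<delta>\<^sup>2 / 2 * (\<Sum>j=1..m. \<Sum>k=1..n. log_dev \<tau> (q (Inl j) + q (Inr k))) \<le> energy m n Z q"
    unfolding energy_def sum_distrib_left by (intro sum_mono low)
  also note en
  finally have "(\<Sum>j=1..m. \<Sum>k=1..n. log_dev \<tau> (q (Inl j) + q (Inr k))) \<le> A * ?N"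
    unfolding mult.assoc by (subst (asm) mult_le_cancel_left_pos) (use \<delta> in auto)
  from center_exists[OF \<open>0 < m\<close> \<open>0 < n\<close> Dmn this]
  obtain j0 where j0: "j0 \<in> {1..m}" and Lk: "(\<Sum>k=1..n. log_dev \<tau> (q (Inl j0) + q (Inr k))) \<le> ?L"
    and Lj: "(\<Sum>j=1..m. log_dev \<tau> (q (Inl j) - q (Inl j0))) \<le> ?L" by blast
  define \<theta> where "\<theta> = q (Inl j0)"
  have \<theta>: "\<bar>\<theta>\<bar> \<le> pi" using qpi[OF InlI[OF j0]] by (simp add: \<theta>_def)
  have small: "real c * log_dev \<tau> y \<le> 1 / 2" if "c \<le> m + n" "\<bar>y\<bar> \<le> 1 / (\<tau> * ?N)" for c y
  proof -
    have "\<tau> * \<bar>y\<bar> \<le> \<tau> * (1 / (\<tau> * ?N))" using that(2) \<tau>0 by (intro mult_left_mono) auto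
    then have "\<bar>\<tau> * y\<bar> \<le> 1 / ?N" using \<tau>0 by (simp add: abs_mult)
    then have "(\<tau> * y)\<^sup>2 \<le> (1 / ?N)\<^sup>2" using abs_le_square_iff[of "\<tau> * y" "1 / ?N"] by simp
    then have "log_dev \<tau> y \<le> (1 / ?N)\<^sup>2 / 2"
      using log_dev_le[of \<tau> y] by (simp add: power_mult_distrib)
    then have "real c * log_dev \<tau> y \<le> ?N * ((1 / ?N)\<^sup>2 / 2)"
      using that(1) by (intro mult_mono log_dev_nonneg) auto
    also have "\<dots> \<le> 1 / 2" using N by (simp add: power2_eq_square)
    finally show ?thesis .
  qed
  \<comment> \<open>Here c is the number of terms affected by the move, n for a row and m for a
    column; both are at least N / D.\<close>
  have gain_le: "?gain \<le> \<delta>\<^sup>2 / 2 * (real c * \<Psi> / 2 - ?L) - D * (2 * ?L + 1)" if "?N \<le> D * c" for c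
  proof -
    have "?N / D \<le> c" using that D by (simp add: field_simps)
    then have "?N / D * \<Psi> \<le> c * \<Psi>" using \<Psi>0 by (rule mult_right_mono)
    then show ?thesis by (intro diff_right_mono mult_left_mono) auto
  qed
  consider (row) j where "j \<in> {1..m}" "\<Psi> \<le> log_dev \<tau> (q (Inl j) - \<theta>)"
    | (col) k where "k \<in> {1..n}" "\<Psi> \<le> log_dev \<tau> (q (Inr k) - - \<theta>)"
  proof -
    have False if H: "\<forall>j\<in>{1..m}. log_dev \<tau> (q (Inl j) - \<theta>) < \<Psi>" "\<forall>k\<in>{1..n}. log_dev \<tau> (q (Inr k) - - \<theta>) < \<Psi>"
    proof -
      \<comment> \<open>The normalisation t_n = 0 is decisive: if column n is near its centre
        -\<theta>, then \<theta> itself is near 0. All coordinates are then near 0, which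
        contradicts the choice of \<open>l\<close>.\<close>
      have c: "log_dev \<tau> \<theta> < \<Psi>" using H(2)[rule_format, of n] q0 \<open>0 < n\<close> by simp
      have "4 * \<Psi> \<le> log_dev \<tau> (q l)"
        using log_dev_ge[OF far(2) qpi[OF far(1)] b] by (simp add: \<Psi>_def)
      moreover have "log_dev \<tau> (q l) < 4 * \<Psi>"
      proof (cases l)
        case (Inl j)
        then show ?thesis using log_dev_add_le[of \<tau> "q l - \<theta>" \<theta>] H(1) c far(1) by fastforce
      next
        case (Inr k)
        then show ?thesis using log_dev_add_le[of \<tau> "q l + \<theta>" "- \<theta>"] H(2) c far(1) by fastforce
      qed
      ultimately show False by simp
    qed
    then show ?thesis using row col by (meson not_le)
  qed
  then show ?thesis
  proof cases
    case row
    show ?thesis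
    proof (rule that[of "Inl j" "\<theta> - q (Inl j)"])
      show "\<bar>\<theta> - q (Inl j)\<bar> \<le> 2 * pi" using \<theta> qpi[OF InlI[OF row(1)]] by linarith
      fix y assume y: "\<bar>y\<bar> \<le> 1 / (\<tau> * ?N)"
      have "?gain \<le> \<delta>\<^sup>2 / 2 * (real (card {1..n}) * \<Psi> / 2 - ?L) - D * (2 * ?L + 1)"
        using gain_le[OF Dmn(2)] by simp
      also have "\<dots> \<le> energy m n Z q - energy m n Z (q(Inl j := q (Inl j) + (\<theta> - q (Inl j) + y)))"
        unfolding energy_diff_Inl[OF row(1)]
        using recentering_gain[of "{1..n}" "\<delta>\<^sup>2 / 2" \<tau> "\<lambda>k. energy_term (Z j k)" D \<theta> "\<lambda>k. q (Inr k)" ?L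
            \<Psi> "q (Inl j)" y] low[OF row(1)] up[OF row(1)] Lk row(2) small[OF _ y, of n] D
        by (simp add: \<theta>_def)
      finally show "\<delta>\<^sup>2 / 2 * (?N / D * (\<tau>\<^sup>2 * b\<^sup>2 / 144) / 2 - ?L) - D * (2 * ?L + 1)
        \<le> energy m n Z q - energy m n Z (q(Inl j := q (Inl j) + (\<theta> - q (Inl j) + y)))"
        by (simp only: \<Psi>_def)
    qed (use row in auto)
  next
    case col
    show ?thesis
    proof (rule that[of "Inr k" "- \<theta> - q (Inr k)"])
      show "\<bar>- \<theta> - q (Inr k)\<bar> \<le> 2 * pi" using \<theta> qpi[OF InrI[OF col(1)]] by linarith
      fix y assume y: "\<bar>y\<bar> \<le> 1 / (\<tau> * ?N)"
      have "?gain \<le> \<delta>\<^sup>2 / 2 * (real (card {1..m}) * \<Psi> / 2 - ?L) - D * (2 * ?L + 1)"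
        using gain_le[OF Dmn(1)] by simp
      also have "\<dots> \<le> energy m n Z q - energy m n Z (q(Inr k := q (Inr k) + (- \<theta> - q (Inr k) + y)))"
        unfolding energy_diff_Inr[OF col(1)]
        using recentering_gain[of "{1..m}" "\<delta>\<^sup>2 / 2" \<tau> "\<lambda>j. energy_term (Z j k)" D "- \<theta>" "\<lambda>j. q (Inl j)" ?L
            \<Psi> "q (Inr k)" y] low[OF _ col(1)] up[OF _ col(1)] Lj col(2) small[OF _ y, of m] D
        by (simp add: \<theta>_def)
      finally show "\<delta>\<^sup>2 / 2 * (?N / D * (\<tau>\<^sup>2 * b\<^sup>2 / 144) / 2 - ?L) - D * (2 * ?L + 1)
        \<le> energy m n Z q - energy m n Z (q(Inr k := q (Inr k) + (- \<theta> - q (Inr k) + y)))"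
        by (simp only: \<Psi>_def)
    qed (use col in auto)
  qed
qed

text \<open>Direction \<open>Inr n\<close> moves \<open>t\<^sub>n\<close> modulo the shift \<open>(s, t) \<mapsto> (s + x, t - x)\<close>, which fixes the energy.\<close>
definition direction :: "nat \<Rightarrow> nat + nat \<Rightarrow> nat + nat \<Rightarrow> real" where
  "direction n i = (if i = Inr n then case_sum (\<lambda>_. 1) (\<lambda>_. - 1) else (\<lambda>l. if l = i then 1 else 0))"

text \<open>For \<open>i = Inr n\<close> the two points differ but have the same sums s_j + t_k: on
  the left all s_j gain x, all t_k with k < n lose x, and t_n is reset to 0, so only the sums with
  t_n change, by x. For other \<open>i\<close> the relevant coordinates agree.\<close>

lemma energy_shift_direction:
  assumes "i \<in> {1..m} <+> {1..n}"
  shows "energy m n Z ((shift ({1..m} <+> {1..<n}) (\<lambda>l. x * direction n i l) p)(Inr n := 0))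
    = energy m n Z (p(Inr n := 0, i := (p(Inr n := 0)) i + x))"
  unfolding energy_def
proof (intro sum.cong refl arg_cong2[of _ _ _ _ energy_term])
  fix j k assume "j \<in> {1..m}" "k \<in> {1..n}"
  then show "((shift ({1..m} <+> {1..<n}) (\<lambda>l. x * direction n i l) p)(Inr n := 0)) (Inl j) +
       ((shift ({1..m} <+> {1..<n}) (\<lambda>l. x * direction n i l) p)(Inr n := 0)) (Inr k) =
       (p(Inr n := 0, i := (p(Inr n := 0)) i + x)) (Inl j) + (p(Inr n := 0, i := (p(Inr n := 0)) i + x)) (Inr k)"
    using assms by (auto simp: shift_def direction_def)
qed

lemma energy_periodic:
  "energy m n Z (p(i := p i + 2 * pi)) = energy m n Z p"
proof -
  have "energy_term z (u + 2 * pi) = energy_term z u" for z u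
    by (simp add: energy_term_def)
  moreover have "cos (a + (b + 2 * pi)) = cos (a + b)" for a b :: real
    by (metis add.assoc cos_periodic)
  moreover have "cos (a + 2 * pi + b) = cos (a + b)" for a b :: real
    by (metis add.assoc add.commute cos_periodic)
  ultimately show ?thesis
    unfolding energy_def energy_term_def by (cases i) (auto intro!: sum.cong)
qed

text \<open>Each of the m n \<le> N^2 terms is at most 2 (1 + 1/\<delta>) / N^2, as \<tau> |s_j +
  t_k| \<le> 2/N. This bounds the full integral from below by the volume of a small box.\<close>

lemma energy_near_zero:
  assumes \<delta>: "0 < \<delta>" "\<delta> \<le> \<tau>" and "0 < m"
    and Z: "\<And>j k. j \<in> {1..m} \<Longrightarrow> k \<in> {1..n} \<Longrightarrow> 0 \<le> Z j k \<and> Z j k \<le> \<tau>"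
    and q: "\<And>i. i \<in> {1..m} <+> {1..n} \<Longrightarrow> \<bar>q i\<bar> \<le> 1 / (\<tau> * real (m + n))"
  shows "energy m n Z q \<le> 2 * (1 + 1 / \<delta>)"
proof -
  let ?N = "real (m + n)" and ?D = "1 + 1 / \<delta>"
  have \<tau>0: "0 < \<tau>" and N: "0 < ?N" using assms by auto
  have D0: "0 \<le> ?D" using \<delta> by simp
  have "energy_term (Z j k) (q (Inl j) + q (Inr k)) \<le> ?D * (2 / ?N\<^sup>2)"
    if "j \<in> {1..m}" "k \<in> {1..n}" for j k
  proof -
    let ?u = "q (Inl j) + q (Inr k)"
    have "\<bar>?u\<bar> \<le> 1 / (\<tau> * ?N) + 1 / (\<tau> * ?N)"
      using q[OF InlI[OF that(1)]] q[OF InrI[OF that(2)]]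
      by (intro order_trans[OF abs_triangle_ineq] add_mono)
    then have "\<tau> * \<bar>?u\<bar> \<le> \<tau> * (1 / (\<tau> * ?N) + 1 / (\<tau> * ?N))" using \<tau>0 by (intro mult_left_mono) auto
    also have "\<dots> = 2 / ?N" using \<tau>0 N by (simp add: field_simps del: of_nat_add)
    finally have "\<bar>\<tau> * ?u\<bar> \<le> \<bar>2 / ?N\<bar>" using \<tau>0 N by (simp add: abs_mult)
    then have "(\<tau> * ?u)\<^sup>2 \<le> (2 / ?N)\<^sup>2" by (simp only: abs_le_square_iff)
    then have "\<tau>\<^sup>2 * ?u\<^sup>2 / 2 \<le> 2 / ?N\<^sup>2" by (simp add: power_mult_distrib power_divide)
    then have "log_dev \<tau> ?u \<le> 2 / ?N\<^sup>2" using log_dev_le[of \<tau> ?u] by linarith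
    then have "?D * log_dev \<tau> ?u \<le> ?D * (2 / ?N\<^sup>2)" using D0 by (rule mult_left_mono)
    moreover have "energy_term (Z j k) ?u \<le> ?D * log_dev \<tau> ?u"
      using Z[OF that] \<delta> by (intro energy_term_upper) auto
    ultimately show ?thesis by linarith
  qed
  then have "energy m n Z q \<le> (\<Sum>j=1..m. \<Sum>k=1..n. ?D * (2 / ?N\<^sup>2))"
    unfolding energy_def by (intro sum_mono)
  also have "\<dots> = ?D * (2 / ?N\<^sup>2) * (real m * real n)" by simp
  also have "\<dots> \<le> ?D * (2 / ?N\<^sup>2) * ?N\<^sup>2"
    using D0 by (intro mult_left_mono) (auto simp: power2_eq_square intro!: mult_mono)
  also have "\<dots> = 2 * ?D" using N by simp
  finally show ?thesis .
qed

section \<open>The tail bound\<close>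

text \<open>On the left is the contribution of high energies over the whole torus, on the right half
  the permitted error times the contribution of the small box, in dimension c. The volumes differ by
  the factor (pi \<tau> N)^c, which is only exp (O (N ln N)) because \<tau> is polynomially bounded,
  so a large K absorbs it.\<close>

lemma negligible_part_le:
  fixes N \<tau> \<delta> \<kappa> K C :: real
  assumes N: "1 \<le> N" and \<tau>: "0 < \<tau>" "\<tau> \<le> N powr (1 / \<delta>)" and \<delta>: "0 < \<delta>" and c: "real c \<le> N"
    and le: "ln 2 + \<kappa> * ln N + C + N * (ln pi + (1 + 1 / \<delta>) * ln N) \<le> K * (N * ln N)"
  shows "exp (- (K * (N * ln N))) * (2 * pi) ^ c
    \<le> N powr - \<kappa> / 2 * (exp (- C) * (2 / (\<tau> * N)) ^ c)"
proof -
  \<comment> \<open>The logarithm of pi N^(1 + 1/\<delta>), an upper bound for ln (pi \<tau>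
    N).\<close>
  let ?E = "ln pi + (1 + 1 / \<delta>) * ln N"
  have lpi: "0 < ln pi" using pi_gt3 by simp
  have lN: "0 \<le> ln N" using N by simp
  have E0: "0 \<le> ?E" using lpi lN \<delta> by (intro add_nonneg_nonneg mult_nonneg_nonneg) auto
  have "pi * (\<tau> * N) \<le> pi * (N powr (1 / \<delta>) * N)"
    using \<tau> N by (intro mult_left_mono mult_right_mono) auto
  also have "\<dots> = exp ?E"
    using N by (simp add: exp_add powr_def distrib_right)
  finally have "(pi * (\<tau> * N)) ^ c \<le> exp ?E ^ c"
    using \<tau> N by (intro power_mono) auto
  also have "\<dots> = exp (real c * ?E)" by (simp add: exp_of_nat_mult)
  also have "\<dots> \<le> exp (N * ?E)" using c E0 by (simp add: mult_right_mono)
  finally have 1: "(pi * (\<tau> * N)) ^ c \<le> exp (N * ?E)" .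
  have "(2 * pi) ^ c = (pi * (\<tau> * N)) ^ c * (2 / (\<tau> * N)) ^ c"
    unfolding power_mult_distrib[symmetric] using \<tau> N by (intro arg_cong[where f = "\<lambda>x. x ^ c"]) simp
  also have "\<dots> \<le> exp (N * ?E) * (2 / (\<tau> * N)) ^ c"
    using 1 \<tau> N by (intro mult_right_mono) auto
  finally have "exp (- (K * (N * ln N))) * (2 * pi) ^ c
      \<le> exp (- (K * (N * ln N))) * (exp (N * ?E) * (2 / (\<tau> * N)) ^ c)"
    by (rule mult_left_mono) simp
  also have "\<dots> = exp (N * ?E - K * (N * ln N)) * (2 / (\<tau> * N)) ^ c"
    by (simp add: exp_diff exp_minus field_simps)
  also have "\<dots> \<le> exp (- ln 2 - \<kappa> * ln N - C) * (2 / (\<tau> * N)) ^ c"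
    using le \<tau> N by (intro mult_right_mono) auto
  also have "exp (- ln 2 - \<kappa> * ln N - C) = N powr - \<kappa> / 2 * exp (- C)"
    using N by (simp add: exp_diff powr_def exp_minus exp_add field_simps)
  finally show ?thesis by (simp add: mult.assoc)
qed

lemma measurable_insert_zero [measurable]:
  fixes m n :: nat
  assumes "0 < n"
  shows "(\<lambda>p. p(Inr n := 0)) \<in> measurable (\<Pi>\<^sub>M i\<in>{1..m} <+> {1..<n}. (lborel :: real measure))
    (\<Pi>\<^sub>M i\<in>{1..m} <+> {1..n}. borel)"
proof (rule measurable_fun_upd)
  show "{1..m} <+> {1..n} = ({1..m} <+> {1..<n}) \<union> {Inr n}"
  proof -
    have "{1..n} = insert n {1..<n}" using assms by auto
    then show ?thesis unfolding Plus_def by auto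
  qed
  have "(\<lambda>x. x) \<in> measurable (\<Pi>\<^sub>M i\<in>{1..m} <+> {1..<n}. (lborel :: real measure)) (\<Pi>\<^sub>M i\<in>{1..m} <+> {1..<n}. lborel)"
    by measurable
  then show "(\<lambda>x. x) \<in> measurable (\<Pi>\<^sub>M i\<in>{1..m} <+> {1..<n}. (lborel :: real measure)) (\<Pi>\<^sub>M i\<in>{1..m} <+> {1..<n}. borel)"
    by (subst measurable_cong_sets[OF refl sets_PiM_cong[where N="\<lambda>_. lborel"]]) auto
qed simp

lemma measurable_energy [measurable]:
  "energy m n Z \<in> borel_measurable (\<Pi>\<^sub>M i\<in>{1..m} <+> {1..n}. borel)"
proof -
  have "(\<lambda>p. p (Inl j) + p (Inr k)) \<in> borel_measurable (\<Pi>\<^sub>M i\<in>{1..m} <+> {1..n}. (borel :: real measure))"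
    if "j \<in> {1..m}" "k \<in> {1..n}" for j k
    using that by (intro borel_measurable_add measurable_component_singleton) auto
  then have "(\<lambda>p. energy_term (Z j k) (p (Inl j) + p (Inr k)))
      \<in> borel_measurable (\<Pi>\<^sub>M i\<in>{1..m} <+> {1..n}. borel)"
    if "j \<in> {1..m}" "k \<in> {1..n}" for j k
    using that by (intro measurable_compose[of "\<lambda>p. p (Inl j) + p (Inr k)" _ borel "energy_term (Z j k)"])
      (auto simp: energy_term_def[abs_def])
  then show ?thesis
    unfolding energy_def[abs_def] by (intro borel_measurable_sum)
qed

text \<open>The main estimate, with all requirements on the size of N kept as hypotheses.
  \<open>gain\<close> makes the descent beat the losses of averaging, and \<open>neg\<close> makes
  the high-energy part negligible; each part receives half of the permitted error.\<close>

lemma energy_tail_bound: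
  fixes \<delta> \<kappa> K \<tau> :: real and m n :: nat and Z :: "nat \<Rightarrow> nat \<Rightarrow> real"
  defines "D \<equiv> 1 + 1 / \<delta>" and "N \<equiv> real (m + n)"
  defines "I \<equiv> {1..m} <+> {1..<n}" and "b \<equiv> ln N / (\<tau> * sqrt N)"
  defines "M \<equiv> \<Pi>\<^sub>M i\<in>I. lborel" and "g \<equiv> \<lambda>p. ennreal (exp (- energy m n Z (p(Inr n := 0))))"
    and "Q \<equiv> \<Pi>\<^sub>E i\<in>I. {- pi..pi}"
    and "V \<equiv> {p. \<forall>i\<in>{1..m} <+> {1..n}. \<bar>(p(Inr n := 0)) i\<bar> \<le> b}"
  assumes \<delta>: "0 < \<delta>" "\<delta> < 1" and mn0: "0 < m" "0 < n"
    and mn: "\<delta> * real n \<le> real m" "\<delta> * real m \<le> real n"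
    and \<tau>: "\<delta> \<le> \<tau>" "\<tau> \<le> N powr (1 / \<delta>)"
    and Z: "\<And>j k. j \<in> {1..m} \<Longrightarrow> k \<in> {1..n} \<Longrightarrow> \<delta> * \<tau> \<le> Z j k \<and> Z j k \<le> \<tau>"
    and N\<delta>: "1 / \<delta> \<le> N" and lnN: "(ln N)\<^sup>2 / N \<le> 9"
    and gain: "ln 18 + (\<kappa> + 2 + 1 / \<delta>) * ln N
      \<le> \<delta>\<^sup>2 / 2 * ((ln N)\<^sup>2 / (288 * D) - 4 * D\<^sup>2 * (2 * K / \<delta>\<^sup>2 * ln N))
        - D * (2 * (4 * D\<^sup>2 * (2 * K / \<delta>\<^sup>2 * ln N)) + 1)"
    and neg: "ln 2 + \<kappa> * ln N + 2 * D + N * (ln pi + (1 + 1 / \<delta>) * ln N) \<le> K * (N * ln N)"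
  shows "(\<integral>\<^sup>+p. g p * indicator (Q - V) p \<partial>M) \<le> ennreal (N powr - \<kappa>) * (\<integral>\<^sup>+p. g p * indicator Q p \<partial>M)"
proof -
  define \<eta> where "\<eta> = 1 / (\<tau> * N)"
  \<comment> \<open>The reciprocal of 18 N^(\<kappa>+1) N \<tau> times the interval length 2 \<eta>.
    Summed over N directions, each contributing 18 J, it leaves N^(-\<kappa>) / 2.\<close>
  define \<epsilon> where "\<epsilon> = N powr (- \<kappa> - 1) / 36"
  define J where "J = (\<integral>\<^sup>+p. g p * indicator Q p \<partial>M)"
  \<comment> \<open>The window [-9, 9] contains every interval of radius \<eta> \<le> 1 about a
    displacement of size at most 2 pi, as pi < 4. Its length explains the 18 in
    \<open>gain\<close>.\<close>
  define S where "S i p = (\<integral>\<^sup>+x. g (shift I (\<lambda>l. x * direction n i l) p) * indicator {-9..9} x \<partial>lborel)" for i p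
  have finI [simp]: "finite I" by (simp add: I_def)
  have N1: "1 \<le> N" and N0: "0 < N" using mn0 by (auto simp: N_def)
  have lN: "0 \<le> ln N" using N1 by simp
  have \<tau>0: "0 < \<tau>" using \<delta> \<tau> by simp
  have b0: "0 \<le> b" unfolding b_def using \<tau>0 N0 lN by (intro divide_nonneg_pos) auto
  have \<tau>b: "\<tau>\<^sup>2 * b\<^sup>2 = (ln N)\<^sup>2 / N"
    using \<tau>0 N0 by (simp add: b_def power_divide power_mult_distrib)
  have \<tau>b9: "\<tau>\<^sup>2 * b\<^sup>2 \<le> 9" using lnN by (simp add: \<tau>b)
  have D: "1 \<le> D" using \<delta> by (simp add: D_def)
  have "1 \<le> \<delta> * N" using N\<delta> \<delta> by (simp add: field_simps)
  also have "\<dots> \<le> \<tau> * N" using \<tau> N0 by (intro mult_right_mono) auto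
  finally have \<eta>: "0 < \<eta>" "\<eta> \<le> 1" using \<tau>0 N0 by (simp_all add: \<eta>_def)
  have z0: "0 \<le> Z j k" if "j \<in> {1..m}" "k \<in> {1..n}" for j k
    using Z[OF that] \<delta> \<tau>0 by (meson mult_nonneg_nonneg less_imp_le order_trans)
  have gm [measurable]: "g \<in> borel_measurable M"
    unfolding g_def M_def I_def using mn0 by measurable
  have emQ: "emeasure M Q = ennreal ((2 * pi) ^ card I)"
    unfolding Q_def M_def by (simp add: emeasure_PiM_cube)
  have [measurable]: "Q \<in> sets M" unfolding Q_def M_def by (intro sets_PiM_I_finite) auto
  have per: "g (p(i := p i + 2 * pi)) = g p" if "i \<in> I" for p i
  proof -
    have "p(i := p i + 2 * pi, Inr n := 0) = p(Inr n := 0, i := (p(Inr n := 0)) i + 2 * pi)"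
      using that by (auto simp: I_def fun_eq_iff)
    then show ?thesis by (simp only: g_def energy_periodic)
  qed
  have Sint: "(\<integral>\<^sup>+p. S i p * indicator Q p \<partial>M) = ennreal 18 * J" for i
    unfolding S_def J_def M_def Q_def
    using nn_integral_torus_line_average[OF finI gm[unfolded M_def], of 9 "direction n i"] per by simp
  have Sm [measurable]: "S i \<in> borel_measurable M" for i
  proof -
    have sm [measurable]: "(\<lambda>z. shift I (\<lambda>l. snd z * direction n i l) (fst z)) \<in> measurable (M \<Otimes>\<^sub>M lborel) M"
      unfolding shift_def M_def by measurable
    have "(\<lambda>(p, x). g (shift I (\<lambda>l. x * direction n i l) p)) \<in> borel_measurable (M \<Otimes>\<^sub>M lborel)"
      using measurable_compose[OF sm gm] by (simp add: case_prod_beta')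
    then show ?thesis
      unfolding S_def using sigma_finite_lborel
      by (intro sigma_finite_measure.borel_measurable_nn_integral) (auto simp: case_prod_beta')
  qed
  have pointwise: "g p \<le> ennreal (exp (- (K * (N * ln N)))) + ennreal \<epsilon> * (\<Sum>i\<in>{1..m} <+> {1..n}. S i p)"
    if p: "p \<in> Q - V" for p
  proof (cases "energy m n Z (p(Inr n := 0)) \<le> K * (N * ln N)")
    case False
    then have "g p \<le> ennreal (exp (- (K * (N * ln N))))" unfolding g_def by (intro ennreal_leI) simp
    then show ?thesis by (rule order_trans) simp
  next
    case True
    let ?q = "p(Inr n := 0)"
    have qpi: "\<bar>?q i\<bar> \<le> pi" if "i \<in> {1..m} <+> {1..n}" for i
    proof (cases "i = Inr n")
      case False
      then have "i \<in> I" using that by (auto simp: I_def)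
      then have "p i \<in> {-pi..pi}" using p unfolding Q_def by blast
      then show ?thesis using False by (auto simp: abs_le_iff)
    qed simp
    obtain l where l: "l \<in> {1..m} <+> {1..n}" "b < \<bar>?q l\<bar>"
      using p by (auto simp: V_def not_le)
    \<comment> \<open>This is the choice A = 2 K ln N / \<delta>^2, for which the energy bound of
      \<open>descent_coordinate\<close> is K N ln N.\<close>
    have en: "energy m n Z ?q \<le> \<delta>\<^sup>2 / 2 * (2 * K / \<delta>\<^sup>2 * ln N) * real (m + n)"
      unfolding N_def[symmetric] using True \<delta> by (simp add: mult_ac)
    obtain i x where i: "i \<in> {1..m} <+> {1..n}" and x: "\<bar>x\<bar> \<le> 2 * pi"
      and dec: "\<And>y. \<bar>y\<bar> \<le> \<eta> \<Longrightarrow> \<delta>\<^sup>2 / 2 * (N / D * (\<tau>\<^sup>2 * b\<^sup>2 / 144) / 2 - 4 * D\<^sup>2 * (2 * K / \<delta>\<^sup>2 * ln N))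
          - D * (2 * (4 * D\<^sup>2 * (2 * K / \<delta>\<^sup>2 * ln N)) + 1) \<le> energy m n Z ?q - energy m n Z (?q(i := ?q i + (x + y)))"
      using descent_coordinate[OF \<delta> mn0 mn \<tau>(1) Z b0 \<tau>b9 _ qpi l en, folded D_def N_def, folded \<eta>_def]
      by (metis fun_upd_same)
    have "N / D * (\<tau>\<^sup>2 * b\<^sup>2 / 144) / 2 = (ln N)\<^sup>2 / (288 * D)"
      using N0 by (simp add: \<tau>b)
    then have dec': "ln 18 + (\<kappa> + 2 + 1 / \<delta>) * ln N
        \<le> energy m n Z ?q - energy m n Z (?q(i := ?q i + (x + y)))" if "\<bar>y\<bar> \<le> \<eta>" for y
      using dec[OF that] gain by (simp only:)
    \<comment> \<open>The factors have separate purposes: 18 pays for the window, N^(\<kappa>+1)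
      gives the saving with one N for the number of directions, and N N^(1/\<delta>) \<ge> N \<tau>
      = 1/\<eta> pays for the short interval of descent.\<close>
    have e18: "exp (ln 18 + (\<kappa> + 2 + 1 / \<delta>) * ln N) = 18 * (N powr (\<kappa> + 1) * N * N powr (1 / \<delta>))"
    proof -
      have "ln 18 + (\<kappa> + 2 + 1 / \<delta>) * ln N = ln 18 + ((\<kappa> + 1) * ln N + ln N + 1 / \<delta> * ln N)"
        by (simp add: algebra_simps)
      then show ?thesis using N0 by (simp only: exp_add powr_def) simp
    qed
    have gs: "ennreal (18 * (N powr (\<kappa> + 1) * N * \<tau>)) * g p * indicator {x - \<eta>..x + \<eta>} y
      \<le> g (shift I (\<lambda>l. y * direction n i l) p) * indicator {-9..9} y" for y
    proof (cases "y \<in> {x - \<eta>..x + \<eta>}")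
      case True
      have y9: "y \<in> {-9..9}" using True x \<eta> pi_less_4 by auto
      have "18 * (N powr (\<kappa> + 1) * N * \<tau>) * exp (- energy m n Z ?q)
          \<le> exp (ln 18 + (\<kappa> + 2 + 1 / \<delta>) * ln N) * exp (- energy m n Z ?q)"
        unfolding e18 using \<tau> N0 by (intro mult_right_mono mult_left_mono) auto
      also have "\<dots> \<le> exp (- energy m n Z (?q(i := ?q i + (x + (y - x)))))"
        unfolding exp_add[symmetric] using dec'[of "y - x"] True by (simp add: abs_le_iff)
      finally have le: "18 * (N powr (\<kappa> + 1) * N * \<tau>) * exp (- energy m n Z ?q)
          \<le> exp (- energy m n Z (?q(i := ?q i + (x + (y - x)))))" .
      have "ennreal (18 * (N powr (\<kappa> + 1) * N * \<tau>)) * g p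
          = ennreal (18 * (N powr (\<kappa> + 1) * N * \<tau>) * exp (- energy m n Z ?q))"
        unfolding g_def using N0 \<tau>0 by (intro ennreal_mult'[symmetric]) auto
      also have "\<dots> \<le> ennreal (exp (- energy m n Z (?q(i := ?q i + (x + (y - x))))))"
        using le by (rule ennreal_leI)
      also have "\<dots> = g (shift I (\<lambda>l. y * direction n i l) p)"
        unfolding g_def I_def energy_shift_direction[OF i] by simp
      finally show ?thesis using True y9 by simp
    qed simp
    have "ennreal (18 * (N powr (\<kappa> + 1) * N * \<tau>)) * g p * ennreal (2 * \<eta>)
      = (\<integral>\<^sup>+y. ennreal (18 * (N powr (\<kappa> + 1) * N * \<tau>)) * g p * indicator {x - \<eta>..x + \<eta>} y \<partial>lborel)"
      using \<eta> by (subst nn_integral_cmult_indicator) auto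
    also have "\<dots> \<le> S i p" unfolding S_def by (intro nn_integral_mono gs)
    \<comment> \<open>The direction depends on p; summing over all of them removes this dependence,
      so no measurable choice has to be made.\<close>
    also have "\<dots> \<le> (\<Sum>i\<in>{1..m} <+> {1..n}. S i p)" using i by (intro member_le_sum) auto
    finally have "ennreal \<epsilon> * (ennreal (18 * (N powr (\<kappa> + 1) * N * \<tau>)) * g p * ennreal (2 * \<eta>))
      \<le> ennreal \<epsilon> * (\<Sum>i\<in>{1..m} <+> {1..n}. S i p)" by (rule mult_left_mono) simp
    moreover have "ennreal \<epsilon> * (ennreal (18 * (N powr (\<kappa> + 1) * N * \<tau>)) * g p * ennreal (2 * \<eta>)) = g p"
    proof -
      have "N powr (- \<kappa> - 1) * N powr (\<kappa> + 1) = 1"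
        using N0 by (simp add: powr_add[symmetric])
      then have "\<epsilon> * (18 * (N powr (\<kappa> + 1) * N * \<tau>)) * (2 * \<eta>) = 1"
        using N0 \<tau>0 by (simp add: \<epsilon>_def \<eta>_def field_simps)
      then have "ennreal \<epsilon> * ennreal (18 * (N powr (\<kappa> + 1) * N * \<tau>)) * ennreal (2 * \<eta>) = 1"
        using N0 \<tau>0 \<eta> by (simp add: ennreal_mult'[symmetric] \<epsilon>_def)
      then show ?thesis by (metis (no_types, lifting) mult.assoc mult.commute mult.left_neutral)
    qed
    ultimately show ?thesis by (simp add: add_increasing)
  qed
  have "(\<integral>\<^sup>+p. g p * indicator (Q - V) p \<partial>M)
    \<le> (\<integral>\<^sup>+p. ennreal (exp (- (K * (N * ln N)))) * indicator Q p
        + ennreal \<epsilon> * (\<Sum>i\<in>{1..m} <+> {1..n}. S i p * indicator Q p) \<partial>M)"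
  proof (rule nn_integral_mono)
    fix p
    show "g p * indicator (Q - V) p \<le> ennreal (exp (- (K * (N * ln N)))) * indicator Q p
        + ennreal \<epsilon> * (\<Sum>i\<in>{1..m} <+> {1..n}. S i p * indicator Q p)"
      using pointwise[of p] by (cases "p \<in> Q - V") auto
  qed
  also have "\<dots> = ennreal (exp (- (K * (N * ln N)))) * emeasure M Q
      + ennreal \<epsilon> * (\<Sum>i\<in>{1..m} <+> {1..n}. \<integral>\<^sup>+p. S i p * indicator Q p \<partial>M)"
  proof -
    have "(\<integral>\<^sup>+p. ennreal \<epsilon> * (\<Sum>i\<in>{1..m} <+> {1..n}. S i p * indicator Q p) \<partial>M)
        = ennreal \<epsilon> * (\<integral>\<^sup>+p. (\<Sum>i\<in>{1..m} <+> {1..n}. S i p * indicator Q p) \<partial>M)"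
      by (rule nn_integral_cmult) measurable
    also have "(\<integral>\<^sup>+p. (\<Sum>i\<in>{1..m} <+> {1..n}. S i p * indicator Q p) \<partial>M)
        = (\<Sum>i\<in>{1..m} <+> {1..n}. \<integral>\<^sup>+p. S i p * indicator Q p \<partial>M)"
      by (rule nn_integral_sum) measurable
    finally show ?thesis
      by (subst nn_integral_add) (measurable, simp only: nn_integral_cmult_indicator[OF \<open>Q \<in> sets M\<close>])
  qed
  also have "\<dots> = ennreal (exp (- (K * (N * ln N)))) * ennreal ((2 * pi) ^ card I)
      + ennreal \<epsilon> * (of_nat (m + n) * (ennreal 18 * J))"
    by (simp only: Sint emQ sum_constant) (simp add: card_Plus)
  also have "\<dots> \<le> ennreal (N powr - \<kappa> / 2) * J + ennreal (N powr - \<kappa> / 2) * J"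
  proof (rule add_mono)
    \<comment> \<open>A cube about the origin on which the energy is at most 2 D; its volume is the
      lower bound for J against which the high-energy part is measured.\<close>
    let ?R = "\<Pi>\<^sub>E i\<in>I. {-\<eta>..\<eta>}"
    have [measurable]: "?R \<in> sets M" unfolding M_def by (intro sets_PiM_I_finite) auto
    have "ennreal (exp (- (2 * D))) * ennreal ((2 * \<eta>) ^ card I) = (\<integral>\<^sup>+p. ennreal (exp (- (2 * D))) * indicator ?R p \<partial>M)"
      using \<eta> by (simp add: nn_integral_cmult_indicator M_def emeasure_PiM_cube)
    also have "\<dots> \<le> J" unfolding J_def
    proof (rule nn_integral_mono)
      fix p
      show "ennreal (exp (- (2 * D))) * indicator ?R p \<le> g p * indicator Q p"
      proof (cases "p \<in> ?R")
        case True
        then have "p i \<in> {-\<eta>..\<eta>}" if "i \<in> I" for i using that by blast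
        then have pI: "\<bar>p i\<bar> \<le> \<eta>" if "i \<in> I" for i using that by (force simp: abs_le_iff)
        have "\<bar>(p(Inr n := 0)) i\<bar> \<le> 1 / (\<tau> * real (m + n))" if "i \<in> {1..m} <+> {1..n}" for i
        proof (cases "i = Inr n")
          case False
          then have "i \<in> I" using that by (auto simp: I_def)
          then show ?thesis using pI False by (simp add: \<eta>_def N_def)
        qed (use \<eta> in \<open>simp add: \<eta>_def N_def\<close>)
        then have "energy m n Z (p(Inr n := 0)) \<le> 2 * D"
          unfolding D_def using Z z0 by (intro energy_near_zero[OF \<delta>(1) \<tau>(1) mn0(1)]) auto
        moreover have "{-\<eta>..\<eta>} \<subseteq> {-pi..pi}" using \<eta> pi_gt3 by auto
        then have "p \<in> Q" using True unfolding Q_def by (auto simp: PiE_iff)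
        ultimately show ?thesis using True by (auto simp: g_def intro!: ennreal_leI)
      qed simp
    qed
    finally have J: "ennreal (exp (- (2 * D)) * (2 * \<eta>) ^ card I) \<le> J" by (simp add: ennreal_mult')
    have "real (card I) \<le> N" by (simp add: I_def N_def card_Plus)
    from negligible_part_le[OF N1 \<tau>0 \<tau>(2) \<delta>(1) this neg]
    have "ennreal (exp (- (K * (N * ln N))) * (2 * pi) ^ card I)
        \<le> ennreal (N powr - \<kappa> / 2 * (exp (- (2 * D)) * (2 * \<eta>) ^ card I))"
      by (intro ennreal_leI) (simp add: \<eta>_def)
    also have "\<dots> = ennreal (N powr - \<kappa> / 2) * ennreal (exp (- (2 * D)) * (2 * \<eta>) ^ card I)"
      by (intro ennreal_mult') simp
    also have "\<dots> \<le> ennreal (N powr - \<kappa> / 2) * J" by (intro mult_left_mono J) simp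
    finally show "ennreal (exp (- (K * (N * ln N)))) * ennreal ((2 * pi) ^ card I) \<le> ennreal (N powr - \<kappa> / 2) * J"
      by (simp add: ennreal_mult')
  next
    have "\<epsilon> * (N * 18) = N powr - \<kappa> / 2"
      using N0 powr_add[of N "- \<kappa> - 1" 1] by (simp add: \<epsilon>_def)
    then have "ennreal \<epsilon> * (ennreal N * ennreal 18) = ennreal (N powr - \<kappa> / 2)"
      using N0 by (simp add: ennreal_mult'[symmetric] \<epsilon>_def del: ennreal_numeral)
    moreover have "of_nat (m + n) = ennreal N" by (simp only: N_def ennreal_of_nat_eq_real_of_nat)
    ultimately show "ennreal \<epsilon> * (of_nat (m + n) * (ennreal 18 * J)) \<le> ennreal (N powr - \<kappa> / 2) * J"
      by (simp only: mult.assoc[symmetric])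
  qed
  also have "\<dots> = ennreal (N powr - \<kappa>) * J"
    by (simp add: distrib_right[symmetric] ennreal_plus[symmetric] del: ennreal_plus)
  finally show ?thesis unfolding J_def .
qed

section \<open>From nonnegative integrals to integrals over the hyperplane\<close>

text \<open>This holds without integrability: for an infinite integral both the Bochner integral and
  \<open>enn2real\<close> take the value 0.\<close>

lemma set_integral_hyperplane_measure:
  assumes "0 < n" and A: "A \<in> sets (\<Pi>\<^sub>M i\<in>{1..m} <+> {1..n}. borel)"
    and f: "f \<in> borel_measurable (\<Pi>\<^sub>M i\<in>{1..m} <+> {1..n}. borel)" and "\<And>p. 0 \<le> f p"
  shows "(LINT p:A|hyperplane_measure m n. f p)
    = enn2real (\<integral>\<^sup>+p. ennreal (f (p(Inr n := 0))) * indicator A (p(Inr n := 0)) \<partial>(\<Pi>\<^sub>M i\<in>{1..m} <+> {1..<n}. lborel))"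
proof -
  note [measurable] = A f measurable_insert_zero[OF assms(1)]
  have Af [measurable]: "(\<lambda>p. indicator A p *\<^sub>R f p) \<in> borel_measurable (\<Pi>\<^sub>M i\<in>{1..m} <+> {1..n}. borel)"
    by measurable
  have "(LINT p:A|hyperplane_measure m n. f p)
      = (\<integral>p. indicator A (p(Inr n := 0)) *\<^sub>R f (p(Inr n := 0)) \<partial>(\<Pi>\<^sub>M i\<in>{1..m} <+> {1..<n}. lborel))"
    unfolding set_lebesgue_integral_def hyperplane_measure_def
    by (rule integral_distr[OF measurable_insert_zero[OF assms(1)] Af])
  also have "\<dots> = enn2real (\<integral>\<^sup>+p. ennreal (indicator A (p(Inr n := 0)) *\<^sub>R f (p(Inr n := 0))) \<partial>(\<Pi>\<^sub>M i\<in>{1..m} <+> {1..<n}. lborel))"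
    using assms(4) measurable_compose[OF measurable_insert_zero[OF assms(1)] Af]
    by (intro integral_eq_nn_integral) auto
  also have "\<dots> = enn2real (\<integral>\<^sup>+p. ennreal (f (p(Inr n := 0))) * indicator A (p(Inr n := 0)) \<partial>(\<Pi>\<^sub>M i\<in>{1..m} <+> {1..<n}. lborel))"
    by (intro arg_cong[where f = enn2real] nn_integral_cong) (auto simp: indicator_def)
  finally show ?thesis .
qed

lemma sets_Pi0_set:
  assumes "0 < n"
  shows "Pi0_set m n \<in> sets (\<Pi>\<^sub>M i\<in>{1..m} <+> {1..n}. borel)"
proof -
  let ?M = "\<Pi>\<^sub>M i\<in>{1..m} <+> {1..n}. (borel :: real measure)"
  have c [measurable]: "(\<lambda>p. p i) \<in> borel_measurable ?M" if "i \<in> {1..m} <+> {1..n}" for i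
    using that by (rule measurable_component_singleton)
  have [measurable]: "(\<lambda>p. p (Inr n)) \<in> borel_measurable ?M" using assms by (intro c) auto
  have "Pi0_set m n = {p \<in> space ?M. p (Inr n) = 0 \<and> (\<forall>i\<in>{1..m} <+> {1..n}. - pi \<le> p i \<and> p i \<le> pi)}"
    by (auto simp: Pi0_set_def space_PiM)
  also have "\<dots> \<in> sets ?M"
    by measurable
  finally show ?thesis .
qed

lemma sets_U_set:
  assumes "0 < n"
  shows "U_set m n \<tau> \<in> sets (\<Pi>\<^sub>M i\<in>{1..m} <+> {1..n}. borel)"
proof -
  let ?M = "\<Pi>\<^sub>M i\<in>{1..m} <+> {1..n}. (borel :: real measure)"
  let ?b = "ln (real (m + n)) / (\<tau> * sqrt (real (m + n)))"
  have c [measurable]: "(\<lambda>p. p i) \<in> borel_measurable ?M" if "i \<in> {1..m} <+> {1..n}" for i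
    using that by (rule measurable_component_singleton)
  note [measurable] = sets_Pi0_set[OF assms]
  have "U_set m n \<tau> = Pi0_set m n \<inter> {p \<in> space ?M. \<forall>i\<in>{1..m} <+> {1..n}. \<bar>p i\<bar> \<le> ?b}"
    by (auto simp: U_set_def Pi0_set_def space_PiM)
  also have "\<dots> \<in> sets ?M"
    by measurable
  finally show ?thesis .
qed

lemma insert_zero_mem_Pi0_iff:
  assumes "0 < n" "p \<in> extensional ({1..m} <+> {1..<n})"
  shows "p(Inr n := 0) \<in> Pi0_set m n \<longleftrightarrow> p \<in> (\<Pi>\<^sub>E i\<in>{1..m} <+> {1..<n}. {-pi..pi})"
proof -
  have n: "{1..n} = insert n {1..<n}" using assms by auto
  have "p(Inr n := 0) \<in> extensional ({1..m} <+> {1..n})"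
    using assms(2) unfolding n extensional_def by (auto simp: Plus_def)
  then show ?thesis
    using assms(2) unfolding Pi0_set_def n by (auto simp: PiE_iff)
qed

section \<open>The threshold for m + n, and the conclusion\<close>

lemma eventually_ln_le_ln_square:
  fixes a b c :: real
  assumes "0 < c"
  shows "\<forall>\<^sub>F N in at_top. b + a * ln N \<le> c * (ln N)\<^sup>2"
  using assms by real_asymp

lemma eventually_ln_linear_le:
  fixes a b c :: real
  shows "\<forall>\<^sub>F N in at_top. a + b * ln N + c * N \<le> N * ln N"
proof -
  have "((\<lambda>N. (a + b * ln N + c * N) / (N * ln N)) \<longlongrightarrow> 0) at_top" by real_asymp
  then have "\<forall>\<^sub>F N in at_top. (a + b * ln N + c * N) / (N * ln N) < 1"
    by (rule order_tendstoD) simp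
  then show ?thesis using eventually_gt_at_top[of 1]
    by eventually_elim (simp add: field_simps)
qed

theorem theorem7p1:
  fixes \<delta> \<kappa> :: real
  assumes "0 < \<delta>" and "\<delta> < 1" and "0 < \<kappa>"
  shows "\<exists>\<gamma>>0. \<forall>(m::nat) (n::nat) (R :: nat \<Rightarrow> nat) (C :: nat \<Rightarrow> nat)
            (Z :: nat \<Rightarrow> nat \<Rightarrow> real) (\<tau>::real).
     0 < m \<longrightarrow> 0 < n \<longrightarrow>
     (\<forall>j\<in>{1..m}. 0 < R j) \<longrightarrow> (\<forall>k\<in>{1..n}. 0 < C k) \<longrightarrow>
     (\<Sum>j=1..m. R j) = (\<Sum>k=1..n. C k) \<longrightarrow>
     typical_matrix m n R C Z \<longrightarrow>
     \<delta> * real n \<le> real m \<longrightarrow> \<delta> * real m \<le> real n \<longrightarrow>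
     \<delta> \<le> \<tau> \<longrightarrow> \<tau> \<le> real (m + n) powr (1 / \<delta>) \<longrightarrow>
     (\<forall>j\<in>{1..m}. \<forall>k\<in>{1..n}. \<delta> * \<tau> \<le> Z j k \<and> Z j k \<le> \<tau>) \<longrightarrow>
     real (m + n) > (\<gamma>::real) \<longrightarrow>
     (LINT p:(Pi0_set m n - U_set m n \<tau>)|hyperplane_measure m n. cmod (F_fun m n R C Z p))
       \<le> real (m + n) powr (- \<kappa>)
           * (LINT p:Pi0_set m n|hyperplane_measure m n. cmod (F_fun m n R C Z p))"
proof -
  define D where "D = 1 + 1 / \<delta>"
  \<comment> \<open>The volume ratio in \<open>neg\<close> costs D N ln N; the additional N ln N
    absorbs the terms of lower order.\<close>
  define K where "K = D + 1"
  define E where "E = 4 * D\<^sup>2 * (2 * K / \<delta>\<^sup>2)"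
  have D: "0 < D" using assms by (simp add: D_def add_pos_pos)
  \<comment> \<open>The hypothesis \<open>gain\<close> with its terms collected: K and hence E
    depend only on \<delta>, so the losses are linear in ln N while the gain is quadratic.\<close>
  have "\<forall>\<^sub>F N in at_top. (ln 18 + D) + (\<kappa> + 2 + 1 / \<delta> + \<delta>\<^sup>2 / 2 * E + 2 * D * E) * ln N
      \<le> \<delta>\<^sup>2 / 2 / (288 * D) * (ln N)\<^sup>2"
    using assms D by (intro eventually_ln_le_ln_square divide_pos_pos) auto
  moreover have "\<forall>\<^sub>F N in at_top. (ln 2 + 2 * D) + \<kappa> * ln N + ln pi * N \<le> N * ln N"
    by (rule eventually_ln_linear_le)
  moreover have "\<forall>\<^sub>F N in at_top. (ln N)\<^sup>2 / N \<le> (9::real)"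
    by real_asymp
  ultimately have "\<forall>\<^sub>F N in at_top. 1 / \<delta> \<le> N \<and> (ln N)\<^sup>2 / N \<le> 9 \<and>
      ln 18 + (\<kappa> + 2 + 1 / \<delta>) * ln N
        \<le> \<delta>\<^sup>2 / 2 * ((ln N)\<^sup>2 / (288 * D) - 4 * D\<^sup>2 * (2 * K / \<delta>\<^sup>2 * ln N))
          - D * (2 * (4 * D\<^sup>2 * (2 * K / \<delta>\<^sup>2 * ln N)) + 1) \<and>
      ln 2 + \<kappa> * ln N + 2 * D + N * (ln pi + (1 + 1 / \<delta>) * ln N) \<le> K * (N * ln N)"
    using eventually_ge_at_top[of "1 / \<delta>"]
  proof eventually_elim
    case (elim N)
    have E: "4 * D\<^sup>2 * (2 * K / \<delta>\<^sup>2 * ln N) = E * ln N" by (simp add: E_def)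
    have "\<delta>\<^sup>2 / 2 * ((ln N)\<^sup>2 / (288 * D) - E * ln N) - D * (2 * (E * ln N) + 1)
       = \<delta>\<^sup>2 / 2 / (288 * D) * (ln N)\<^sup>2 - (\<delta>\<^sup>2 / 2 * E + 2 * D * E) * ln N - D"
      by (simp add: algebra_simps)
    moreover have "K * (N * ln N) = N * ((1 + 1 / \<delta>) * ln N) + N * ln N"
      by (simp add: K_def D_def algebra_simps)
    ultimately show ?case
      unfolding E using elim by (simp add: algebra_simps)
  qed
  then obtain \<gamma>0 where \<gamma>0: "\<And>N. \<gamma>0 \<le> N \<Longrightarrow> 1 / \<delta> \<le> N \<and> (ln N)\<^sup>2 / N \<le> 9 \<and>
      ln 18 + (\<kappa> + 2 + 1 / \<delta>) * ln N
        \<le> \<delta>\<^sup>2 / 2 * ((ln N)\<^sup>2 / (288 * D) - 4 * D\<^sup>2 * (2 * K / \<delta>\<^sup>2 * ln N))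
          - D * (2 * (4 * D\<^sup>2 * (2 * K / \<delta>\<^sup>2 * ln N)) + 1) \<and>
      ln 2 + \<kappa> * ln N + 2 * D + N * (ln pi + (1 + 1 / \<delta>) * ln N) \<le> K * (N * ln N)"
    unfolding eventually_at_top_linorder by blast
  show ?thesis
  proof (intro exI[of _ "max 1 \<gamma>0"] conjI allI impI)
    show "0 < max 1 \<gamma>0" by simp
    fix m n :: nat and R C :: "nat \<Rightarrow> nat" and Z :: "nat \<Rightarrow> nat \<Rightarrow> real" and \<tau> :: real
    assume mn0: "0 < m" "0 < n" and mn: "\<delta> * real n \<le> real m" "\<delta> * real m \<le> real n"
      and \<tau>: "\<delta> \<le> \<tau>" "\<tau> \<le> real (m + n) powr (1 / \<delta>)"
      and Z: "\<forall>j\<in>{1..m}. \<forall>k\<in>{1..n}. \<delta> * \<tau> \<le> Z j k \<and> Z j k \<le> \<tau>"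
      and large: "max 1 \<gamma>0 < real (m + n)"
    let ?N = "real (m + n)" and ?F = "\<lambda>p. exp (- energy m n Z p)"
    let ?M = "\<Pi>\<^sub>M i\<in>{1..m} <+> {1..<n}. (lborel :: real measure)" and ?Q = "\<Pi>\<^sub>E i\<in>{1..m} <+> {1..<n}. {-pi..pi}"
    let ?V = "{p. \<forall>i\<in>{1..m} <+> {1..n}. \<bar>(p(Inr n := 0)) i\<bar> \<le> ln ?N / (\<tau> * sqrt ?N)}"
    let ?J = "\<lambda>A. \<integral>\<^sup>+p. ennreal (?F (p(Inr n := 0))) * indicator A p \<partial>?M"
    have Z0: "\<forall>j\<in>{1..m}. \<forall>k\<in>{1..n}. 0 \<le> Z j k"
      using Z \<tau> assms by (meson mult_nonneg_nonneg less_imp_le order_trans)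
    have F: "cmod (F_fun m n R C Z p) = ?F p" for p by (rule cmod_F_fun[OF Z0])
    have Fm: "?F \<in> borel_measurable (\<Pi>\<^sub>M i\<in>{1..m} <+> {1..n}. borel)" by measurable
    have mem: "p(Inr n := 0) \<in> Pi0_set m n \<longleftrightarrow> p \<in> ?Q" if "p \<in> space ?M" for p
      using that by (intro insert_zero_mem_Pi0_iff mn0) (simp add: space_PiM PiE_iff)
    have memU: "p(Inr n := 0) \<in> Pi0_set m n - U_set m n \<tau> \<longleftrightarrow> p \<in> ?Q - ?V" if "p \<in> space ?M" for p
      unfolding Diff_iff mem[OF that, symmetric] by (auto simp: U_set_def)
    have lhs: "(LINT p:(Pi0_set m n - U_set m n \<tau>)|hyperplane_measure m n. ?F p) = enn2real (?J (?Q - ?V))"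
      by (subst set_integral_hyperplane_measure[OF mn0(2) sets.Diff[OF sets_Pi0_set[OF mn0(2)] sets_U_set[OF mn0(2)]] Fm])
         (auto simp: indicator_def memU simp del: Diff_iff intro!: arg_cong[where f = enn2real] nn_integral_cong)
    have rhs: "(LINT p:Pi0_set m n|hyperplane_measure m n. ?F p) = enn2real (?J ?Q)"
      by (subst set_integral_hyperplane_measure[OF mn0(2) sets_Pi0_set[OF mn0(2)] Fm])
         (auto simp: indicator_def mem intro!: arg_cong[where f = enn2real] nn_integral_cong)
    have "\<gamma>0 \<le> ?N" using large by simp
    note num = \<gamma>0[OF this, folded D_def]
    have le: "?J (?Q - ?V) \<le> ennreal (?N powr - \<kappa>) * ?J ?Q"
      using num Z by (intro energy_tail_bound[OF assms(1,2) mn0 mn \<tau>, where K = K, folded D_def]) auto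
    \<comment> \<open>Finiteness of the right-hand side is required since \<open>enn2real\<close>
      sends infinity to 0 and is monotone only below infinity. It holds because |F| \<le> 1 on a
      cube of finite measure.\<close>
    have "energy m n Z p \<ge> 0" for p
      unfolding energy_def energy_term_def using Z0
      by (intro sum_nonneg divide_nonneg_pos ln_ge_zero) auto
    then have "?J ?Q \<le> (\<integral>\<^sup>+p. indicator ?Q p \<partial>?M)"
      by (intro nn_integral_mono) (auto simp: indicator_def)
    also have "\<dots> = emeasure ?M ?Q" by (intro nn_integral_indicator sets_PiM_I_finite) auto
    also have "\<dots> < \<infinity>" by (subst emeasure_PiM_cube) auto
    finally have fin: "?J ?Q < \<infinity>" .
    have "enn2real (?J (?Q - ?V)) \<le> enn2real (ennreal (?N powr - \<kappa>) * ?J ?Q)"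
      using fin by (intro enn2real_mono le) (simp add: ennreal_mult_less_top)
    also have "\<dots> = ?N powr - \<kappa> * enn2real (?J ?Q)" by (simp add: enn2real_mult)
    finally show "(LINT p:(Pi0_set m n - U_set m n \<tau>)|hyperplane_measure m n. cmod (F_fun m n R C Z p))
       \<le> real (m + n) powr (- \<kappa>)
           * (LINT p:Pi0_set m n|hyperplane_measure m n. cmod (F_fun m n R C Z p))"
      unfolding F lhs rhs .
  qed
qed

end
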